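(* Let $A:[0,+\infty)\to\mathbb{R}$ be a continuous function and let $f:\mathbb{R}\to\mathbb{C}$ be the Fourier transform of a complex Borel measure on $\mathbb{R}$ with compact support. Then the classical solution of the initial value problem $$\frac{\partial}{\partial t}u(t,x)=\frac{\alpha}{N!}\frac{\partial^N}{\partial x^N}u(t,x)+A(t)\,x\,u(t,x),\quad t\in[0,\infty),\qquad u(0,x)=f(x),\quad x\in\mathbb{R},$$ is given by $$u(t,x)=\lim_{n\to\infty}\mathbb{E}\left[f(x+W_n(t))\,e^{\int_0^t A(t-s)(W_n(s)+x)\,ds}\right].$$
   Context: Let $N>2$ be an integer and $\alpha\in\mathbb{C}$; fix an $N$-th root $\alpha^{1/N}$ of $\alpha$. Let $\xi$ be a random variable uniformly distributed on $\{\alpha^{1/N}e^{2\pi i k/N}:k=0,\dots,N-1\}$, let $(\xi_k)_{k\ge1}$ be i.i.d. copies of $\xi$ on a probability space, and for each integer $n\ge1$ and real $t\ge0$ set $W_n(t)=n^{-1/N}\sum_{k=1}^{\lfloor nt\rfloor}\xi_k$. The Fourier transform convention is $f(x)=\int_{\mathbb{R}}e^{iyx}\,d\mu(y)$, with $\mu$ a complex Borel measure on $\mathbb{R}$ with compact support; the same formula extends $f$ to an entire function on $\mathbb{C}$, and $f(x+W_n(t))$ refers to this extension. *)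

theory Defs
  imports "HOL-Probability.Probability"
begin

section \<open>Complex Borel measures on the real line\<close>

text \<open>Only the values on Borel sets matter.  As usual, convergence of the series over every
  disjoint sequence is part of the definition, so these measures are automatically finite.\<close>

definition complex_borel_measure :: "(real set \<Rightarrow> complex) \<Rightarrow> bool" where
  "complex_borel_measure \<mu> \<longleftrightarrow>
     \<mu> {} = 0 \<and>
     (\<forall>E :: nat \<Rightarrow> real set. range E \<subseteq> sets borel \<longrightarrow> disjoint_family E \<longrightarrow>
        (\<lambda>n. \<mu> (E n)) sums \<mu> (\<Union>n. E n))"

text \<open>The condition on \<open>U\<close> says that the total variation of \<open>\<mu>\<close> on \<open>U\<close> is positive.\<close>

definition measure_support :: "(real set \<Rightarrow> complex) \<Rightarrow> real set" where
  "measure_support \<mu> =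
     {x. \<forall>U. open U \<longrightarrow> x \<in> U \<longrightarrow> (\<exists>B\<in>sets borel. B \<subseteq> U \<and> \<mu> B \<noteq> 0)}"

text \<open>The positive part of the Jordan decomposition of a real signed measure,
  \<open>\<nu>\<^sup>+(E) = sup {\<nu>(B) | B \<subseteq> E}\<close>; the negative part is the positive part of \<open>- \<nu>\<close>.
  The function \<^const>\<open>ennreal\<close> sends negative numbers to 0, which is harmless here
  because \<open>B = {}\<close> is admitted in the supremum.\<close>

definition positive_variation :: "(real set \<Rightarrow> real) \<Rightarrow> real measure" where
  "positive_variation \<nu> =
     measure_of UNIV (sets borel) (\<lambda>E. SUP B\<in>{B \<in> sets borel. B \<subseteq> E}. ennreal (\<nu> B))"

definition signed_integral :: "(real set \<Rightarrow> real) \<Rightarrow> (real \<Rightarrow> complex) \<Rightarrow> complex" where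
  "signed_integral \<nu> g =
     integral\<^sup>L (positive_variation \<nu>) g - integral\<^sup>L (positive_variation (\<lambda>E. - \<nu> E)) g"

definition complex_measure_integral :: "(real set \<Rightarrow> complex) \<Rightarrow> (real \<Rightarrow> complex) \<Rightarrow> complex" where
  "complex_measure_integral \<mu> g =
     signed_integral (\<lambda>E. Re (\<mu> E)) g + \<i> * signed_integral (\<lambda>E. Im (\<mu> E)) g"

text \<open>On real arguments this is the Fourier transform of \<open>\<mu>\<close>; for compactly supported \<open>\<mu>\<close>
  it is its extension to an entire function.\<close>

definition fourier_extension :: "(real set \<Rightarrow> complex) \<Rightarrow> complex \<Rightarrow> complex" where
  "fourier_extension \<mu> z = complex_measure_integral \<mu> (\<lambda>y. exp (\<i> * complex_of_real y * z))"

section \<open>The random walk\<close>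

text \<open>Here \<open>r\<close> is the chosen \<open>N\<close>-th root of \<open>\<alpha>\<close>.  For \<open>\<alpha> = 0\<close> the set is \<open>{0}\<close>.\<close>

definition scaled_roots :: "nat \<Rightarrow> complex \<Rightarrow> complex set" where
  "scaled_roots N r =
     (\<lambda>k. r * exp (2 * complex_of_real pi * \<i> * of_nat k / of_nat N)) ` {0..N - 1}"

text \<open>The law on the Borel sets of the complex plane; \<^const>\<open>measure_pmf\<close> alone lives on the
  full power set.\<close>

definition uniform_law :: "complex set \<Rightarrow> complex measure" where
  "uniform_law S = distr (measure_pmf (pmf_of_set S)) borel (\<lambda>z. z)"

definition walk :: "nat \<Rightarrow> (nat \<Rightarrow> 'a \<Rightarrow> complex) \<Rightarrow> nat \<Rightarrow> real \<Rightarrow> 'a \<Rightarrow> complex" where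
  "walk N \<xi> n t \<omega> =
     complex_of_real (real n powr (- 1 / real N)) * (\<Sum>k = 1..nat \<lfloor>real n * t\<rfloor>. \<xi> k \<omega>)"

section \<open>Classical solutions\<close>

text \<open>\<open>u\<close> is of class \<open>C\<^sup>1\<close> in \<open>t\<close> and \<open>C\<^sup>N\<close> in \<open>x\<close>, with derivatives jointly continuous on
  \<open>[0,\<infinity>) \<times> \<real>\<close>; \<open>ut\<close> is the time derivative (one-sided at \<open>t = 0\<close>) and \<open>D j\<close> the \<open>j\<close>-th
  derivative in \<open>x\<close>.  Values of \<open>u\<close> at negative times are irrelevant.\<close>

definition classical_solution ::
  "nat \<Rightarrow> complex \<Rightarrow> (real \<Rightarrow> real) \<Rightarrow> (real \<Rightarrow> complex) \<Rightarrow> (real \<Rightarrow> real \<Rightarrow> complex) \<Rightarrow> bool" where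
  "classical_solution N \<alpha> A f u \<longleftrightarrow>
     (\<exists>(ut :: real \<Rightarrow> real \<Rightarrow> complex) (D :: nat \<Rightarrow> real \<Rightarrow> real \<Rightarrow> complex).
        continuous_on ({0..} \<times> UNIV) (\<lambda>(t, x). ut t x) \<and>
        (\<forall>j\<le>N. continuous_on ({0..} \<times> UNIV) (\<lambda>(t, x). D j t x)) \<and>
        (\<forall>t\<ge>0. \<forall>x. D 0 t x = u t x) \<and>
        (\<forall>j<N. \<forall>t\<ge>0. \<forall>x. (D j t has_vector_derivative D (Suc j) t x) (at x)) \<and>
        (\<forall>t\<ge>0. \<forall>x. ((\<lambda>s. u s x) has_vector_derivative ut t x) (at t within {0..})) \<and>
        (\<forall>t\<ge>0. \<forall>x. ut t x = \<alpha> / fact N * D N t x + complex_of_real (A t * x) * u t x) \<and>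
        (\<forall>x. u 0 x = f x))"

end

theory Submission
  imports Defs "HOL-Real_Asymp.Real_Asymp"
begin

text \<open>
  For a single frequency, \<open>\<mu> = \<delta>\<^sub>y\<close>, both sides can be computed.  Put \<open>B(t) = \<integral>\<^sub>0\<^sup>t A\<close>.  On the analytic
  side, the function \<open>exp ((iy + B(t)) x + \<alpha>/N! \<integral>\<^sub>0\<^sup>t (iy + B(s))\<^sup>N ds)\<close>
  solves the equation with initial value \<open>e\<^sup>i\<^sup>y\<^sup>x\<close>: each \<open>x\<close>-derivative brings down a factor \<open>iy + B(t)\<close>, and the
  time derivative brings down \<open>A(t) x + \<alpha> (iy + B(t))\<^sup>N / N!\<close>.

  On the probabilistic side, Abel summation turns \<open>\<integral>\<^sub>0\<^sup>t A(t-s) W\<^sub>n(s) ds\<close> into a weighted sum of the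
  steps: with \<open>h\<close> for \<open>n\<close> to the power \<open>-1/N\<close>, the step \<open>\<xi>\<^sub>k\<close> has weight \<open>h B(t - k/n)\<close>, since it is present
  exactly during \<open>[k/n, t]\<close> (lemma \<open>integral_walk\<close>).  By independence the expectation is
  \<open>exp ((iy + B(t)) x)\<close> times a product of values of the moment generating function \<open>\<phi>(z) = E(exp (\<xi> z))\<close>.
  As \<open>\<xi>\<close> is uniform on the \<open>N\<close>-th roots of \<open>\<alpha>\<close>, its moments of orders \<open>1, \<dots>, N - 1\<close> vanish and
  \<open>\<phi>(z) = 1 + \<alpha> z\<^sup>N / N! + O(\<bar>z\<bar>\<^sup>N\<^sup>+\<^sup>1)\<close>.  The factor of index \<open>k\<close>, which is \<open>\<phi>(h (iy + B(t - k/n)))\<close>, is therefore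
  \<open>1 + \<alpha> (iy + B(t - k/n))\<^sup>N / (N! n)\<close> up to an error \<open>o(1/n)\<close>, and the product converges to the exponential
  of a Riemann integral, which is the integral above after reversing time (lemma \<open>prod_scaled_tendsto\<close>).

  Both sides are then integrated over \<open>y\<close> against \<open>\<mu>\<close>.  All estimates are uniform for \<open>y\<close> in a compact
  set, so that on the compact support of \<open>\<mu>\<close> one may differentiate under the integral, exchange it with
  the expectation and pass to the limit.  This rests on the fact that the four parts
  of the Jordan decomposition of \<open>\<mu>\<close> are finite measures carried by its support, so that bounded
  convergence and Fubini's theorem for finite measures apply to each of them.
\<close>

section \<open>The Jordan decomposition of a signed Borel measure\<close>

locale signed_borel_measure =
  fixes \<nu> :: "real set \<Rightarrow> real"
  assumes empty: "\<nu> {} = 0"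
    and sums: "\<And>E. range E \<subseteq> sets borel \<Longrightarrow> disjoint_family E \<Longrightarrow> (\<lambda>n. \<nu> (E n)) sums \<nu> (\<Union>n. E n)"
begin

lemma additive:
  assumes "X \<in> sets borel" "Y \<in> sets borel" "X \<inter> Y = {}"
  shows "\<nu> (X \<union> Y) = \<nu> X + \<nu> Y"
proof -
  have "disjoint_family (binaryset X Y)"
    using assms by (auto simp: disjoint_family_on_def binaryset_def)
  then have "(\<lambda>n. \<nu> (binaryset X Y n)) sums \<nu> (X \<union> Y)"
    using sums[of "binaryset X Y"] assms by (simp add: range_binaryset_eq UN_binaryset_eq)
  moreover have "(\<lambda>n. \<nu> (binaryset X Y n)) sums (\<nu> X + \<nu> Y)"
    by (rule binaryset_sums) (rule empty)
  ultimately show ?thesis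
    by (rule sums_unique2)
qed

definition upper :: "real set \<Rightarrow> ennreal" where
  "upper E = (SUP B\<in>{B \<in> sets borel. B \<subseteq> E}. ennreal (\<nu> B))"

lemma le_upper: "B \<in> sets borel \<Longrightarrow> B \<subseteq> E \<Longrightarrow> ennreal (\<nu> B) \<le> upper E"
  unfolding upper_def by (rule SUP_upper) auto

lemma upper_mono: "E \<subseteq> F \<Longrightarrow> upper E \<le> upper F"
  unfolding upper_def by (rule SUP_subset_mono) auto

lemma upper_empty: "upper {} = 0"
proof -
  have "{B \<in> sets borel. B \<subseteq> {}} = {{} :: real set}"
    by auto
  then show ?thesis
    by (simp add: upper_def empty)
qed

text \<open>Subsets of two disjoint sets can be united, and their \<open>\<nu>\<close>-values add.  If one of
  the values is negative, it is truncated to 0 and the other subset alone suffices.\<close>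

lemma upper_superadditive:
  assumes "X \<inter> Y = {}"
  shows "upper X + upper Y \<le> upper (X \<union> Y)"
proof -
  have pair: "ennreal (\<nu> B) + ennreal (\<nu> C) \<le> upper (X \<union> Y)"
    if B: "B \<in> sets borel" "B \<subseteq> X" and C: "C \<in> sets borel" "C \<subseteq> Y" for B C
  proof (cases "\<nu> B \<ge> 0 \<and> \<nu> C \<ge> 0")
    case True
    have "\<nu> (B \<union> C) = \<nu> B + \<nu> C"
      using assms B C by (intro additive) auto
    with True have "ennreal (\<nu> B) + ennreal (\<nu> C) = ennreal (\<nu> (B \<union> C))"
      by simp
    also have "\<dots> \<le> upper (X \<union> Y)"
      using B C by (intro le_upper) auto
    finally show ?thesis .
  next
    case False
    have "ennreal (\<nu> B) \<le> upper (X \<union> Y)" "ennreal (\<nu> C) \<le> upper (X \<union> Y)"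
      using B C by (auto intro!: le_upper)
    with False show ?thesis
      by (auto simp: not_le ennreal_neg)
  qed
  have ne: "{B \<in> sets borel. B \<subseteq> Z} \<noteq> {}" for Z :: "real set"
    by blast
  have "upper X + ennreal (\<nu> C) \<le> upper (X \<union> Y)" if C: "C \<in> sets borel" "C \<subseteq> Y" for C
    unfolding upper_def[of X] ennreal_SUP_add_left[OF ne, symmetric]
    by (rule SUP_least) (use pair C in auto)
  then have "(SUP C\<in>{B \<in> sets borel. B \<subseteq> Y}. upper X + ennreal (\<nu> C)) \<le> upper (X \<union> Y)"
    by (intro SUP_least) auto
  then show ?thesis
    by (simp add: upper_def[of Y] ennreal_SUP_add_right[OF ne])
qed

text \<open>A Borel subset of the union is cut into its parts in the \<open>E n\<close>, and \<open>\<nu>\<close> is countably additive.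
  With \<open>upper_superadditive\<close> this makes the positive variation a measure without appeal to a Hahn
  decomposition.\<close>

lemma upper_le_suminf:
  assumes E: "range E \<subseteq> sets borel" "disjoint_family E"
  shows "upper (\<Union>n. E n) \<le> (\<Sum>n. upper (E n))"
  unfolding upper_def[of "\<Union>n. E n"]
proof (rule SUP_least)
  fix B assume "B \<in> {B \<in> sets borel. B \<subseteq> (\<Union>n. E n)}"
  then have B: "B \<in> sets borel" "B = (\<Union>n. B \<inter> E n)"
    by auto
  have "(\<lambda>n. \<nu> (B \<inter> E n)) sums \<nu> (\<Union>n. B \<inter> E n)"
    using E B(1) by (intro sums) (auto simp: disjoint_family_on_def)
  then have "(\<lambda>n. ennreal (\<Sum>i<n. \<nu> (B \<inter> E i))) \<longlonglongrightarrow> ennreal (\<nu> B)"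
    using B(2) by (auto simp: sums_def)
  moreover have "ennreal (\<Sum>i<n. \<nu> (B \<inter> E i)) \<le> (\<Sum>n. upper (E n))" for n
  proof -
    have "ennreal (\<Sum>i<n. \<nu> (B \<inter> E i)) \<le> ennreal (\<Sum>i<n. max 0 (\<nu> (B \<inter> E i)))"
      by (intro ennreal_leI sum_mono) simp
    also have "\<dots> = (\<Sum>i<n. ennreal (max 0 (\<nu> (B \<inter> E i))))"
      by (rule sum_ennreal[symmetric]) simp
    also have "\<dots> \<le> (\<Sum>i<n. upper (E i))"
    proof (rule sum_mono)
      fix i
      have "ennreal (\<nu> (B \<inter> E i)) \<le> upper (E i)"
        using E B(1) by (intro le_upper) auto
      then show "ennreal (max 0 (\<nu> (B \<inter> E i))) \<le> upper (E i)"
        by (simp add: max_def)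
    qed
    also have "\<dots> \<le> (\<Sum>n. upper (E n))"
      by (rule sum_le_suminf) auto
    finally show ?thesis .
  qed
  ultimately show "ennreal (\<nu> B) \<le> (\<Sum>n. upper (E n))"
    by (intro LIMSEQ_le_const2) auto
qed

lemma countably_additive_upper: "countably_additive (sets borel) upper"
proof (rule countably_additiveI, rule antisym)
  fix E :: "nat \<Rightarrow> real set"
  assume E: "range E \<subseteq> sets borel" "disjoint_family E"
  show "upper (\<Union>n. E n) \<le> (\<Sum>n. upper (E n))"
    using E by (rule upper_le_suminf)
  have "(\<Sum>i<n. upper (E i)) \<le> upper (\<Union>i<n. E i)" for n
  proof (induction n)
    case (Suc n)
    have "E i \<inter> E n = {}" if "i < n" for i
      using E(2) that by (auto simp: disjoint_family_on_def)
    then have "(\<Union>i<n. E i) \<inter> E n = {}"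
      by auto
    then have "upper (\<Union>i<n. E i) + upper (E n) \<le> upper (\<Union>i<Suc n. E i)"
      using upper_superadditive[of "\<Union>i<n. E i" "E n"] by (simp add: lessThan_Suc Un_commute)
    then show ?case
      using add_right_mono[OF Suc, of "upper (E n)"] order_trans unfolding sum.lessThan_Suc by blast
  qed simp
  then have "(\<Sum>i<n. upper (E i)) \<le> upper (\<Union>i. E i)" for n
    by (rule order_trans) (auto intro: upper_mono)
  then show "(\<Sum>n. upper (E n)) \<le> upper (\<Union>n. E n)"
    by (intro suminf_le_const) auto
qed

lemma positive_variation_eq_measure_of: "positive_variation \<nu> = measure_of UNIV (sets borel) upper"
  by (simp add: positive_variation_def upper_def[abs_def])

lemma sets_positive_variation [simp]: "sets (positive_variation \<nu>) = sets borel"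
  using sets.sigma_sets_eq[of "borel :: real measure"] by (simp add: positive_variation_eq_measure_of)

lemma space_positive_variation [simp]: "space (positive_variation \<nu>) = UNIV"
  by (simp add: positive_variation_eq_measure_of)

lemma emeasure_positive_variation:
  assumes "E \<in> sets borel"
  shows "emeasure (positive_variation \<nu>) E = upper E"
  unfolding positive_variation_eq_measure_of
  using sets.sigma_algebra_axioms[of "borel :: real measure"] upper_empty countably_additive_upper assms
  by (intro emeasure_measure_of_sigma) (auto simp: positive_def)

text \<open>A subset \<open>X\<close> with \<open>\<nu> X > 1 + \<bar>\<nu> E\<bar>\<close> forces \<open>\<bar>\<nu> (E - X)\<bar> > 1\<close> as well, so whichever of \<open>X\<close> and \<open>E - X\<close>
  still has infinite positive variation can be kept and the other one split off.\<close>

lemma split_infinite_upper: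
  assumes E: "E \<in> sets borel" and inf: "upper E = \<infinity>"
  obtains F where "F \<in> sets borel" "F \<subseteq> E" "upper F = \<infinity>" "1 < \<bar>\<nu> (E - F)\<bar>"
proof -
  have "ennreal (1 + \<bar>\<nu> E\<bar>) < upper E"
    by (simp add: inf)
  then obtain X where X: "X \<in> sets borel" "X \<subseteq> E" "ennreal (1 + \<bar>\<nu> E\<bar>) < ennreal (\<nu> X)"
    unfolding upper_def less_SUP_iff by auto
  then have big: "1 + \<bar>\<nu> E\<bar> < \<nu> X"
    by (subst (asm) ennreal_less_iff) auto
  have "\<nu> (X \<union> (E - X)) = \<nu> X + \<nu> (E - X)"
    using E X by (intro additive) auto
  moreover have "X \<union> (E - X) = E"
    using X by auto
  ultimately have split: "\<nu> E = \<nu> X + \<nu> (E - X)"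
    by simp
  have "emeasure (positive_variation \<nu>) E
      = emeasure (positive_variation \<nu>) X + emeasure (positive_variation \<nu>) (E - X)"
    using E X by (subst plus_emeasure) (auto intro: arg_cong2[where f = emeasure])
  with inf E X have "upper X = \<infinity> \<or> upper (E - X) = \<infinity>"
    by (auto simp: emeasure_positive_variation dest: sym)
  then show ?thesis
  proof
    assume "upper X = \<infinity>"
    with X big split show ?thesis
      by (intro that[of X]) auto
  next
    assume "upper (E - X) = \<infinity>"
    moreover have "E - (E - X) = X"
      using X by auto
    ultimately show ?thesis
      using E X big split by (intro that[of "E - X"]) auto
  qed
qed

text \<open>Otherwise \<open>split_infinite_upper\<close> could be iterated, and would produce disjoint sets on which \<open>\<nu>\<close>
  exceeds 1 in absolute value; the series over these sets could not converge.\<close>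

lemma upper_UNIV_finite: "upper UNIV \<noteq> \<infinity>"
proof
  assume inf: "upper UNIV = \<infinity>"
  have "\<exists>F. \<forall>n. (F n \<in> sets borel \<and> upper (F n) = \<infinity>) \<and>
      (F (Suc n) \<subseteq> F n \<and> 1 < \<bar>\<nu> (F n - F (Suc n))\<bar>)"
  proof (rule dependent_nat_choice)
    show "\<exists>F. F \<in> sets borel \<and> upper F = \<infinity>"
      using inf by (intro exI[of _ UNIV]) simp
  next
    fix E and n :: nat
    assume "E \<in> sets borel \<and> upper E = \<infinity>"
    then obtain F where "F \<in> sets borel" "F \<subseteq> E" "upper F = \<infinity>" "1 < \<bar>\<nu> (E - F)\<bar>"
      using split_infinite_upper[of E] by metis
    then show "\<exists>F. (F \<in> sets borel \<and> upper F = \<infinity>) \<and> F \<subseteq> E \<and> 1 < \<bar>\<nu> (E - F)\<bar>"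
      by blast
  qed
  then obtain F where F: "\<And>n. F n \<in> sets borel" "\<And>n. F (Suc n) \<subseteq> F n"
      "\<And>n. 1 < \<bar>\<nu> (F n - F (Suc n))\<bar>"
    by auto
  have "decseq F"
    using F(2) by (rule decseq_SucI)
  then have later: "F n \<subseteq> F (Suc m)" if "m < n" for m n
    using that by (simp add: decseqD Suc_leI)
  have "(F m - F (Suc m)) \<inter> (F n - F (Suc n)) = {}" if "m \<noteq> n" for m n
    using that later[of m n] later[of n m] by (cases m n rule: linorder_cases) auto
  then have "disjoint_family (\<lambda>n. F n - F (Suc n))"
    by (simp add: disjoint_family_on_def)
  then have "(\<lambda>n. \<nu> (F n - F (Suc n))) sums \<nu> (\<Union>n. F n - F (Suc n))"
    using F(1) by (intro sums) auto
  then have "(\<lambda>n. \<nu> (F n - F (Suc n))) \<longlonglongrightarrow> 0"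
    by (intro summable_LIMSEQ_zero sums_summable)
  then have "\<forall>\<^sub>F n in sequentially. \<bar>\<nu> (F n - F (Suc n))\<bar> < 1"
    by (auto simp: tendsto_iff dist_real_def dest!: spec[of _ 1])
  with F(3) show False
    by (auto simp: eventually_sequentially) (meson less_asym order_refl)
qed

lemma finite_measure_positive_variation: "finite_measure (positive_variation \<nu>)"
  using upper_UNIV_finite by (intro finite_measureI) (simp add: emeasure_positive_variation)

lemma AE_positive_variation:
  assumes K: "K \<in> sets borel" and null: "\<And>B. B \<in> sets borel \<Longrightarrow> B \<subseteq> - K \<Longrightarrow> \<nu> B = 0"
  shows "AE y in positive_variation \<nu>. y \<in> K"
proof (rule AE_I')
  have "upper (- K) = 0"
    using null by (auto simp: upper_def intro!: antisym SUP_least)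
  then show "- K \<in> null_sets (positive_variation \<nu>)"
    using K by (simp add: null_sets_def emeasure_positive_variation)
qed auto

end

text \<open>The complement of the support is a union of open sets on whose Borel subsets \<open>\<mu>\<close> vanishes.  This union
  may be uncountable, but the Lindelof property reduces it to a countable one, to which additivity applies.\<close>

lemma complex_borel_measure_vanishes_off_support:
  assumes \<mu>: "complex_borel_measure \<mu>" and B: "B \<in> sets borel" "B \<subseteq> - measure_support \<mu>"
  shows "\<mu> B = 0"
proof -
  define \<V> where "\<V> = {U. open U \<and> (\<forall>C\<in>sets borel. C \<subseteq> U \<longrightarrow> \<mu> C = 0)}"
  have "\<And>U. U \<in> \<V> \<Longrightarrow> open U"
    by (simp add: \<V>_def)
  then obtain \<W> where \<W>: "\<W> \<subseteq> \<V>" "countable \<W>" "\<Union>\<W> = \<Union>\<V>"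
    using Lindelof[of \<V>] by metis
  have "B \<subseteq> \<Union>\<V>"
  proof
    fix x assume "x \<in> B"
    with B(2) have "x \<notin> measure_support \<mu>"
      by blast
    then obtain U where "open U" "x \<in> U" "\<forall>C\<in>sets borel. C \<subseteq> U \<longrightarrow> \<mu> C = 0"
      unfolding measure_support_def mem_Collect_eq by metis
    then show "x \<in> \<Union>\<V>"
      unfolding \<V>_def by blast
  qed
  show ?thesis
  proof (cases "\<W> = {}")
    case True
    with \<open>B \<subseteq> \<Union>\<V>\<close> \<W> have "B = {}"
      by auto
    with \<mu> show ?thesis
      by (simp add: complex_borel_measure_def)
  next
    case False
    define U where "U = from_nat_into \<W>"
    have U: "range U = \<W>"
      unfolding U_def using False \<W>(2) by (rule range_from_nat_into)
    then have U\<V>: "U n \<in> \<V>" for n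
      using \<W>(1) by auto
    define E where "E = disjointed (\<lambda>n. B \<inter> U n)"
    have "range (\<lambda>n. B \<inter> U n) \<subseteq> sets borel"
      using B(1) U\<V> by (auto simp: \<V>_def)
    then have E: "range E \<subseteq> sets borel"
      unfolding E_def by (rule sets.range_disjointed_sets)
    have "disjoint_family E"
      unfolding E_def by (rule disjoint_family_disjointed)
    moreover have "(\<Union>n. E n) = B"
      unfolding E_def UN_disjointed_eq using \<open>B \<subseteq> \<Union>\<V>\<close> U \<W>(3) by auto
    ultimately have "(\<lambda>n. \<mu> (E n)) sums \<mu> B"
      using \<mu> E unfolding complex_borel_measure_def by metis
    moreover have "\<mu> (E n) = 0" for n
    proof -
      have "E n \<subseteq> U n"
        using disjointed_subset[of "\<lambda>n. B \<inter> U n" n] by (auto simp: E_def)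
      then show ?thesis
        using U\<V>[of n] E unfolding \<V>_def by blast
    qed
    ultimately show ?thesis
      by (simp add: sums_iff)
  qed
qed

section \<open>Integration against a compactly supported complex measure\<close>

locale compactly_carried_measure = finite_measure \<nu> for \<nu> :: "real measure" +
  fixes K :: "real set"
  assumes sets_borel [measurable_cong]: "sets \<nu> = sets borel"
    and compact_carrier: "compact K"
    and AE_carrier: "AE y in \<nu>. y \<in> K"
begin

lemma integrable_continuous:
  fixes g :: "real \<Rightarrow> complex"
  assumes g: "continuous_on UNIV g"
  shows "integrable \<nu> g"
proof -
  have "bounded (g ` K)"
    using g compact_carrier by (metis compact_continuous_image compact_imp_bounded continuous_on_subset subset_UNIV)
  then obtain C where C: "\<And>y. y \<in> K \<Longrightarrow> norm (g y) \<le> C"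
    by (auto simp: bounded_iff)
  have "g \<in> borel_measurable \<nu>"
    using borel_measurable_continuous_onI[OF g] by measurable
  moreover have "AE y in \<nu>. norm (g y) \<le> C"
    using AE_carrier by eventually_elim (rule C)
  ultimately show ?thesis
    by (intro integrable_const_bound)
qed

lemma bounded_convergence:
  fixes g :: "nat \<Rightarrow> real \<Rightarrow> complex"
  assumes g: "\<And>n. continuous_on UNIV (g n)" and h: "continuous_on UNIV h"
    and lim: "\<And>y. y \<in> K \<Longrightarrow> (\<lambda>n. g n y) \<longlonglongrightarrow> h y"
    and bound: "\<And>n y. y \<in> K \<Longrightarrow> norm (g n y) \<le> C"
  shows "(\<lambda>n. integral\<^sup>L \<nu> (g n)) \<longlonglongrightarrow> integral\<^sup>L \<nu> h"
proof (rule integral_dominated_convergence[where w = "\<lambda>_. C"])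
  show "h \<in> borel_measurable \<nu>" "\<And>n. g n \<in> borel_measurable \<nu>"
    using integrable_continuous[OF g] integrable_continuous[OF h] by auto
  show "AE y in \<nu>. (\<lambda>n. g n y) \<longlonglongrightarrow> h y"
    using AE_carrier by eventually_elim (rule lim)
  show "AE y in \<nu>. norm (g n y) \<le> C" for n
    using AE_carrier by eventually_elim (rule bound)
qed simp

lemma Fubini_bounded:
  fixes F :: "real \<Rightarrow> 'a \<Rightarrow> complex"
  assumes M: "prob_space M"
    and F [measurable]: "(\<lambda>(y, \<omega>). F y \<omega>) \<in> borel_measurable (borel \<Otimes>\<^sub>M M)"
    and bound: "AE \<omega> in M. \<forall>y\<in>K. norm (F y \<omega>) \<le> C"
  shows "integrable M (\<lambda>\<omega>. \<integral>y. F y \<omega> \<partial>\<nu>)"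
    and "(\<integral>\<omega>. (\<integral>y. F y \<omega> \<partial>\<nu>) \<partial>M) = (\<integral>y. (\<integral>\<omega>. F y \<omega> \<partial>M) \<partial>\<nu>)"
proof -
  interpret M: prob_space M by fact
  interpret P: pair_sigma_finite \<nu> M ..
  have sets: "sets (\<nu> \<Otimes>\<^sub>M M) = sets (borel \<Otimes>\<^sub>M M)"
    by (intro sets_pair_measure_cong sets_borel refl)
  then have [measurable]: "(\<lambda>(y, \<omega>). F y \<omega>) \<in> borel_measurable (\<nu> \<Otimes>\<^sub>M M)"
    using F by (simp cong: measurable_cong_sets)
  have "AE p in \<nu> \<Otimes>\<^sub>M M. norm (case p of (y, \<omega>) \<Rightarrow> F y \<omega>) \<le> C"
  proof (rule P.AE_pair_measure)
    show "{p \<in> space (\<nu> \<Otimes>\<^sub>M M). norm (case p of (y, \<omega>) \<Rightarrow> F y \<omega>) \<le> C} \<in> sets (\<nu> \<Otimes>\<^sub>M M)"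
      by measurable
    show "AE y in \<nu>. AE \<omega> in M. norm (case (y, \<omega>) of (y, \<omega>) \<Rightarrow> F y \<omega>) \<le> C"
      using AE_carrier
    proof eventually_elim
      case (elim y)
      show ?case
        using bound by eventually_elim (use elim in auto)
    qed
  qed
  moreover have "finite_measure (\<nu> \<Otimes>\<^sub>M M)"
    by (rule finite_measure_pair_measure) unfold_locales
  ultimately have int: "integrable (\<nu> \<Otimes>\<^sub>M M) (\<lambda>(y, \<omega>). F y \<omega>)"
    by (intro finite_measure.integrable_const_bound) auto
  show "integrable M (\<lambda>\<omega>. \<integral>y. F y \<omega> \<partial>\<nu>)"
    using P.integrable_snd[OF int] .
  show "(\<integral>\<omega>. (\<integral>y. F y \<omega> \<partial>\<nu>) \<partial>M) = (\<integral>y. (\<integral>\<omega>. F y \<omega> \<partial>M) \<partial>\<nu>)"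
    using P.Fubini_integral[OF int] .
qed

end

lemma continuous_on_section:
  assumes "continuous_on (S \<times> UNIV) (\<lambda>(p, y). g p y)" "p \<in> S"
  shows "continuous_on UNIV (g p)"
proof -
  have "continuous_on UNIV (\<lambda>y. case (p, y) of (p, y) \<Rightarrow> g p y)"
    by (rule continuous_on_compose2[OF assms(1)]) (use assms(2) in \<open>auto intro!: continuous_intros\<close>)
  then show ?thesis
    by simp
qed

text \<open>The uniform bound that dominated convergence asks for: a convergent sequence stays in a closed ball,
  whose product with a compact set is compact.\<close>

lemma bounded_near_limit:
  fixes S :: "'p::heine_borel set" and K :: "'q::metric_space set"
    and g :: "'p \<Rightarrow> 'q \<Rightarrow> 'b::real_normed_vector"
  assumes S: "closed S" and K: "compact K"
    and g: "continuous_on (S \<times> UNIV) (\<lambda>(p, y). g p y)" and X: "X \<longlonglongrightarrow> p"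
  obtains e C where "e > 0" "\<And>n. X n \<in> cball p e"
    "\<And>q y. q \<in> S \<inter> cball p e \<Longrightarrow> y \<in> K \<Longrightarrow> norm (g q y) \<le> C"
proof -
  obtain e where e: "e > 0" "range X \<subseteq> ball p e"
    using bounded_subset_ballD[OF convergent_imp_bounded[OF X]] by blast
  have "compact ((S \<inter> cball p e) \<times> K)"
    using S K by (intro compact_Times closed_Int_compact) auto
  then have "bounded ((\<lambda>(q, y). g q y) ` ((S \<inter> cball p e) \<times> K))"
    by (intro compact_imp_bounded compact_continuous_image continuous_on_subset[OF g]) auto
  then obtain C where "\<forall>z\<in>(\<lambda>(q, y). g q y) ` ((S \<inter> cball p e) \<times> K). norm z \<le> C"
    unfolding bounded_iff by blast
  then have "norm (g q y) \<le> C" if "q \<in> S \<inter> cball p e" "y \<in> K" for q y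
    using that by blast
  moreover have "X n \<in> cball p e" for n
    using e(2) ball_subset_cball by blast
  ultimately show ?thesis
    using e(1) that by blast
qed

lemma complex_measure_integral_mult_left:
  "complex_measure_integral \<mu> (\<lambda>y. c * g y) = c * complex_measure_integral \<mu> g"
  by (simp add: complex_measure_integral_def signed_integral_def algebra_simps)

locale compactly_supported_complex_measure =
  fixes \<mu> :: "real set \<Rightarrow> complex"
  assumes complex_borel_measure: "complex_borel_measure \<mu>"
    and compact_support: "compact (measure_support \<mu>)"
begin

text \<open>For \<open>L\<close> one of \<open>Re\<close>, \<open>Im\<close> and their negatives, this gives the four parts of the Jordan
  decomposition.\<close>

lemma compactly_carried_part:
  fixes L :: "complex \<Rightarrow> real"
  assumes L: "bounded_linear L"
  shows "compactly_carried_measure (positive_variation (\<lambda>E. L (\<mu> E))) (measure_support \<mu>)"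
proof -
  interpret L: bounded_linear L by fact
  interpret signed_borel_measure "\<lambda>E. L (\<mu> E)"
    using complex_borel_measure
    by unfold_locales (auto simp: complex_borel_measure_def L.zero intro!: L.sums)
  show ?thesis
    unfolding compactly_carried_measure_def compactly_carried_measure_axioms_def
    using finite_measure_positive_variation compact_support borel_compact[OF compact_support]
      complex_borel_measure_vanishes_off_support[OF complex_borel_measure]
    by (auto intro!: AE_positive_variation simp: L.zero)
qed

sublocale re_pos: compactly_carried_measure "positive_variation (\<lambda>E. Re (\<mu> E))" "measure_support \<mu>"
  by (rule compactly_carried_part) (rule bounded_linear_Re)

sublocale re_neg: compactly_carried_measure "positive_variation (\<lambda>E. - Re (\<mu> E))" "measure_support \<mu>"
  by (rule compactly_carried_part) (intro bounded_linear_minus bounded_linear_Re)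

sublocale im_pos: compactly_carried_measure "positive_variation (\<lambda>E. Im (\<mu> E))" "measure_support \<mu>"
  by (rule compactly_carried_part) (rule bounded_linear_Im)

sublocale im_neg: compactly_carried_measure "positive_variation (\<lambda>E. - Im (\<mu> E))" "measure_support \<mu>"
  by (rule compactly_carried_part) (intro bounded_linear_minus bounded_linear_Im)

lemmas integrable_parts =
  re_pos.integrable_continuous re_neg.integrable_continuous
  im_pos.integrable_continuous im_neg.integrable_continuous

lemma integral_zero: "complex_measure_integral \<mu> (\<lambda>_. 0) = 0"
  by (simp add: complex_measure_integral_def signed_integral_def)

lemma integral_add:
  assumes "continuous_on UNIV g" "continuous_on UNIV h"
  shows "complex_measure_integral \<mu> (\<lambda>y. g y + h y)
    = complex_measure_integral \<mu> g + complex_measure_integral \<mu> h"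
  using integrable_parts[OF assms(1)] integrable_parts[OF assms(2)]
  by (simp add: complex_measure_integral_def signed_integral_def algebra_simps)

lemma integral_diff:
  assumes "continuous_on UNIV g" "continuous_on UNIV h"
  shows "complex_measure_integral \<mu> (\<lambda>y. g y - h y)
    = complex_measure_integral \<mu> g - complex_measure_integral \<mu> h"
  using integral_add[of g "\<lambda>y. -1 * h y"] complex_measure_integral_mult_left[of \<mu> "-1" h] assms
  by (simp add: continuous_on_minus)

lemma integral_scaleR:
  "complex_measure_integral \<mu> (\<lambda>y. c *\<^sub>R g y) = c *\<^sub>R complex_measure_integral \<mu> g"
  by (simp add: scaleR_conv_of_real complex_measure_integral_mult_left)

lemma bounded_convergence:
  fixes g :: "nat \<Rightarrow> real \<Rightarrow> complex"
  assumes "\<And>n. continuous_on UNIV (g n)" "continuous_on UNIV h"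
    and "\<And>y. y \<in> measure_support \<mu> \<Longrightarrow> (\<lambda>n. g n y) \<longlonglongrightarrow> h y"
    and "\<And>n y. y \<in> measure_support \<mu> \<Longrightarrow> norm (g n y) \<le> C"
  shows "(\<lambda>n. complex_measure_integral \<mu> (g n)) \<longlonglongrightarrow> complex_measure_integral \<mu> h"
  unfolding complex_measure_integral_def signed_integral_def
  by (intro tendsto_intros re_pos.bounded_convergence[where C = C] re_neg.bounded_convergence[where C = C]
      im_pos.bounded_convergence[where C = C] im_neg.bounded_convergence[where C = C] assms)

lemma Fubini_bounded:
  fixes F :: "real \<Rightarrow> 'a \<Rightarrow> complex"
  assumes "prob_space M" "(\<lambda>(y, \<omega>). F y \<omega>) \<in> borel_measurable (borel \<Otimes>\<^sub>M M)"
    and "AE \<omega> in M. \<forall>y\<in>measure_support \<mu>. norm (F y \<omega>) \<le> C"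
  shows "(\<integral>\<omega>. complex_measure_integral \<mu> (\<lambda>y. F y \<omega>) \<partial>M)
    = complex_measure_integral \<mu> (\<lambda>y. \<integral>\<omega>. F y \<omega> \<partial>M)"
  using re_pos.Fubini_bounded[OF assms] re_neg.Fubini_bounded[OF assms]
    im_pos.Fubini_bounded[OF assms] im_neg.Fubini_bounded[OF assms]
  by (simp add: complex_measure_integral_def signed_integral_def)

lemma continuous_parameter_integral:
  fixes S :: "'p::heine_borel set" and g :: "'p \<Rightarrow> real \<Rightarrow> complex"
  assumes S: "closed S" and g: "continuous_on (S \<times> UNIV) (\<lambda>(p, y). g p y)"
  shows "continuous_on S (\<lambda>p. complex_measure_integral \<mu> (g p))"
  unfolding continuous_on_sequentially comp_def
proof (intro allI ballI impI, elim conjE)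
  fix p X
  assume p: "p \<in> S" and X: "\<forall>n. X n \<in> S" "X \<longlonglongrightarrow> p"
  obtain e C where e: "\<And>n. X n \<in> cball p e"
    and C: "\<And>q y. q \<in> S \<inter> cball p e \<Longrightarrow> y \<in> measure_support \<mu> \<Longrightarrow> norm (g q y) \<le> C"
    using bounded_near_limit[OF S compact_support g X(2)] by metis
  show "(\<lambda>n. complex_measure_integral \<mu> (g (X n))) \<longlonglongrightarrow> complex_measure_integral \<mu> (g p)"
  proof (rule bounded_convergence[where C = C])
    fix y :: real
    have "continuous_on S (\<lambda>q. case (q, y) of (q, y) \<Rightarrow> g q y)"
      by (rule continuous_on_compose2[OF g]) (auto intro!: continuous_intros)
    then show "(\<lambda>n. g (X n) y) \<longlonglongrightarrow> g p y"
      using p X unfolding continuous_on_sequentially comp_def by auto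
  qed (use continuous_on_section[OF g] p X C e in auto)
qed

text \<open>The derivative may be one-sided, as needed for the time variable at 0.  The remainder of the first order
  expansion tends to 0 for each \<open>y\<close>, and the mean value inequality on a neighbourhood of \<open>s\<close> bounds
  it by twice a bound for \<open>g'\<close>; so its integral tends to 0 too.\<close>

lemma has_vector_derivative_parameter_integral:
  fixes S :: "real set" and g g' :: "real \<Rightarrow> real \<Rightarrow> complex"
  assumes S: "closed S" "convex S"
    and g: "\<And>s. s \<in> S \<Longrightarrow> continuous_on UNIV (g s)"
    and g': "continuous_on (S \<times> UNIV) (\<lambda>(s, y). g' s y)"
    and deriv: "\<And>s y. s \<in> S \<Longrightarrow> ((\<lambda>s. g s y) has_vector_derivative g' s y) (at s within S)"
    and s: "s \<in> S"
  shows "((\<lambda>s. complex_measure_integral \<mu> (g s)) has_vector_derivative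
    complex_measure_integral \<mu> (g' s)) (at s within S)"
  unfolding has_vector_derivative_def has_derivative_within tendsto_at_iff_sequentially comp_def
proof (intro conjI allI impI)
  fix X
  assume X: "\<forall>n. X n \<in> S - {s}" "X \<longlonglongrightarrow> s"
  define R where "R n y = (1 / norm (X n - s)) *\<^sub>R (g (X n) y - (g s y + (X n - s) *\<^sub>R g' s y))" for n y
  obtain e C where e: "e > 0" "\<And>n. X n \<in> cball s e"
    and C: "\<And>q y. q \<in> S \<inter> cball s e \<Longrightarrow> y \<in> measure_support \<mu> \<Longrightarrow> norm (g' q y) \<le> C"
    using bounded_near_limit[OF S(1) compact_support g' X(2)] by metis
  note slice = continuous_on_section[OF g']
  have cont: "continuous_on UNIV (R n)" for n
    unfolding R_def using X s by (intro continuous_intros g slice) auto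
  have bound: "norm (R n y) \<le> 2 * C" if y: "y \<in> measure_support \<mu>" for n y
  proof -
    have "norm (g (X n) y - g s y) \<le> C * norm (X n - s)"
    proof (rule differentiable_bound)
      show "convex (S \<inter> cball s e)"
        using S by (intro convex_Int) auto
      show "((\<lambda>s. g s y) has_derivative (\<lambda>h. h *\<^sub>R g' q y)) (at q within S \<inter> cball s e)"
        if "q \<in> S \<inter> cball s e" for q
        using deriv[of q y] that unfolding has_vector_derivative_def
        by (auto intro: has_derivative_subset)
      show "onorm (\<lambda>h::real. h *\<^sub>R g' q y) \<le> C" if "q \<in> S \<inter> cball s e" for q
        using C[of q y] that y by (simp add: onorm_scaleR_left[of "\<lambda>h. h", simplified] onorm_id)
    qed (use X e s in auto)
    moreover have "norm ((X n - s) *\<^sub>R g' s y) \<le> C * norm (X n - s)"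
      using C[of s y] e y s by (auto simp: mult.commute intro!: mult_right_mono)
    ultimately have "norm (g (X n) y - (g s y + (X n - s) *\<^sub>R g' s y)) \<le> 2 * C * norm (X n - s)"
      using norm_triangle_ineq4[of "g (X n) y - g s y" "(X n - s) *\<^sub>R g' s y"] by (simp add: diff_diff_eq)
    moreover have "norm (X n - s) > 0"
      using X by auto
    ultimately show ?thesis
      by (simp add: R_def divide_simps)
  qed
  have "(\<lambda>n. complex_measure_integral \<mu> (R n)) \<longlonglongrightarrow> complex_measure_integral \<mu> (\<lambda>_. 0)"
  proof (rule bounded_convergence[OF cont _ _ bound])
    fix y
    show "(\<lambda>n. R n y) \<longlonglongrightarrow> 0"
      using deriv[OF s, of y] X
      unfolding R_def has_vector_derivative_def has_derivative_within tendsto_at_iff_sequentially comp_def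
      by auto
  qed auto
  moreover have "complex_measure_integral \<mu> (R n) =
      (1 / norm (X n - s)) *\<^sub>R (complex_measure_integral \<mu> (g (X n)) -
        (complex_measure_integral \<mu> (g s) + (X n - s) *\<^sub>R complex_measure_integral \<mu> (g' s)))" for n
    unfolding R_def using X s
    by (simp only: integral_scaleR integral_diff integral_add g slice continuous_intros Diff_iff)
  ultimately show "(\<lambda>n. (1 / norm (X n - s)) *\<^sub>R (complex_measure_integral \<mu> (g (X n)) -
        (complex_measure_integral \<mu> (g s) + (X n - s) *\<^sub>R complex_measure_integral \<mu> (g' s))))
      \<longlonglongrightarrow> 0"
    by (simp add: integral_zero)
qed (simp add: bounded_linear_scaleR_left)

end

section \<open>The explicit solution\<close>

lemma primitive_has_vector_derivative:
  fixes f :: "real \<Rightarrow> 'b::banach"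
  assumes f: "continuous_on {0..} f" and t: "t \<ge> 0"
  shows "((\<lambda>t. integral {0..t} f) has_vector_derivative f t) (at t within {0..})"
proof -
  have "((\<lambda>t. integral {0..t} f) has_vector_derivative f t) (at t within {0..t + 1})"
    using t by (intro integral_has_vector_derivative continuous_on_subset[OF f]) auto
  moreover have "at t within {0..t + 1} = at t within {0..}"
    by (rule at_within_nhd[where S = "{..<t + 1}"]) auto
  ultimately show ?thesis
    by simp
qed

lemma continuous_on_primitive:
  fixes f :: "real \<Rightarrow> 'b::banach"
  assumes "continuous_on {0..} f"
  shows "continuous_on {0..} (\<lambda>t. integral {0..t} f)"
  by (rule continuous_on_vector_derivative) (use assms in \<open>auto intro: primitive_has_vector_derivative\<close>)

text \<open>The potential \<open>A(t) x\<close> moves the complex frequency of the wave \<open>e\<^sup>i\<^sup>y\<^sup>x\<close> from \<open>iy\<close> to \<open>iy + B(t)\<close> at time \<open>t\<close>;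
  \<open>phase\<close> accumulates the symbol \<open>\<zeta>\<^sup>N\<close> of the differential operator along this path, and \<open>mode\<close> is the
  solution with initial value \<open>e\<^sup>i\<^sup>y\<^sup>x\<close>.\<close>

definition drift :: "(real \<Rightarrow> real) \<Rightarrow> real \<Rightarrow> real" where
  "drift A t = integral {0..t} A"

definition frequency :: "(real \<Rightarrow> real) \<Rightarrow> real \<Rightarrow> real \<Rightarrow> complex" where
  "frequency A t y = \<i> * complex_of_real y + complex_of_real (drift A t)"

definition phase :: "nat \<Rightarrow> (real \<Rightarrow> real) \<Rightarrow> real \<Rightarrow> real \<Rightarrow> complex" where
  "phase N A t y = integral {0..t} (\<lambda>s. frequency A s y ^ N)"

definition mode :: "nat \<Rightarrow> complex \<Rightarrow> (real \<Rightarrow> real) \<Rightarrow> real \<Rightarrow> real \<Rightarrow> real \<Rightarrow> complex" where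
  "mode N \<alpha> A t x y = exp (frequency A t y * complex_of_real x + \<alpha> / fact N * phase N A t y)"

lemma drift_has_vector_derivative:
  assumes "continuous_on {0..} A" "t \<ge> 0"
  shows "(drift A has_vector_derivative A t) (at t within {0..})"
  using primitive_has_vector_derivative[OF assms] by (simp add: drift_def[abs_def])

lemma continuous_on_drift: "continuous_on {0..} A \<Longrightarrow> continuous_on {0..} (drift A)"
  using continuous_on_primitive[of A] by (simp add: drift_def[abs_def])

lemma continuous_on_frequency:
  assumes "continuous_on {0..} A"
  shows "continuous_on {0..} (\<lambda>t. frequency A t y)"
  unfolding frequency_def using continuous_on_drift[OF assms] by (intro continuous_intros)

text \<open>A polynomial in \<open>y\<close> whose coefficients depend only on \<open>t\<close>: this makes joint continuity evident.\<close>

lemma phase_expansion: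
  assumes A: "continuous_on {0..} A" and t: "t \<ge> 0"
  shows "phase N A t y =
    (\<Sum>k\<le>N. of_nat (N choose k) * (\<i> * complex_of_real y) ^ k *
      integral {0..t} (\<lambda>s. complex_of_real (drift A s) ^ (N - k)))"
proof -
  have cont: "continuous_on {0..t} (drift A)"
    using continuous_on_drift[OF A] by (rule continuous_on_subset) auto
  have "phase N A t y = integral {0..t} (\<lambda>s. \<Sum>k\<le>N. of_nat (N choose k) * (\<i> * complex_of_real y) ^ k *
      complex_of_real (drift A s) ^ (N - k))"
    unfolding phase_def frequency_def by (simp add: binomial_ring)
  also have "\<dots> = (\<Sum>k\<le>N. integral {0..t} (\<lambda>s. of_nat (N choose k) * (\<i> * complex_of_real y) ^ k *
      complex_of_real (drift A s) ^ (N - k)))"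
    by (intro integral_sum integrable_continuous_real continuous_intros cont) auto
  finally show ?thesis
    by (simp add: mult.assoc)
qed

lemma continuous_on_mode:
  assumes A: "continuous_on {0..} A"
  shows "continuous_on (({0..} \<times> UNIV) \<times> UNIV)
    (\<lambda>(p, y). frequency A (fst p) y ^ j * mode N \<alpha> A (fst p) (snd p) y)"
proof -
  let ?S = "({0..} \<times> UNIV) \<times> UNIV :: ((real \<times> real) \<times> real) set"
  have fst: "continuous_on ?S (\<lambda>q. h (fst (fst q)))" if "continuous_on {0..} h" for h :: "real \<Rightarrow> 'c::topological_space"
    by (rule continuous_on_compose2[OF that]) (auto intro!: continuous_intros)
  have freq: "continuous_on ?S (\<lambda>q. frequency A (fst (fst q)) (snd q))"
    unfolding frequency_def by (intro continuous_intros fst continuous_on_drift A)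
  have "continuous_on ?S (\<lambda>q. phase N A (fst (fst q)) (snd q)) \<longleftrightarrow>
      continuous_on ?S (\<lambda>q. \<Sum>k\<le>N. of_nat (N choose k) * (\<i> * complex_of_real (snd q)) ^ k *
        integral {0..fst (fst q)} (\<lambda>s. complex_of_real (drift A s) ^ (N - k)))"
    by (intro continuous_on_cong refl) (auto simp: phase_expansion[OF A])
  also have \<dots>
    by (intro continuous_intros fst[OF continuous_on_primitive] continuous_on_drift A)
  finally have "continuous_on ?S (\<lambda>q. phase N A (fst (fst q)) (snd q))" .
  with freq show ?thesis
    unfolding mode_def case_prod_beta by (intro continuous_intros) auto
qed

lemma continuous_on_mode_compose:
  assumes A: "continuous_on {0..} A" and h: "continuous_on S t" "continuous_on S x" "continuous_on S y"
    and t: "\<And>p. p \<in> S \<Longrightarrow> t p \<ge> 0"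
  shows "continuous_on S (\<lambda>p. frequency A (t p) (y p) ^ j * mode N \<alpha> A (t p) (x p) (y p))"
proof -
  have "continuous_on S (\<lambda>p. case ((t p, x p), y p) of
      (p, y) \<Rightarrow> frequency A (fst p) y ^ j * mode N \<alpha> A (fst p) (snd p) y)"
    by (rule continuous_on_compose2[OF continuous_on_mode[OF A]]) (use h t in \<open>auto intro!: continuous_intros\<close>)
  then show ?thesis
    by simp
qed

lemma mode_space_derivative:
  "((\<lambda>x. frequency A t y ^ j * mode N \<alpha> A t x y) has_vector_derivative
    frequency A t y ^ Suc j * mode N \<alpha> A t x y) (at x)"
proof -
  have "((\<lambda>x. frequency A t y * complex_of_real x + \<alpha> / fact N * phase N A t y) has_vector_derivative
      frequency A t y) (at x)"
    by (auto intro!: derivative_eq_intros)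
  then have "(exp \<circ> (\<lambda>x. frequency A t y * complex_of_real x + \<alpha> / fact N * phase N A t y) has_vector_derivative
      frequency A t y * mode N \<alpha> A t x y) (at x)"
    by (rule field_vector_diff_chain_at) (simp add: mode_def DERIV_exp)
  then show ?thesis
    by (auto simp: comp_def mode_def mult_ac dest: has_vector_derivative_mult_right[where a = "frequency A t y ^ j"])
qed

lemma mode_time_derivative:
  assumes A: "continuous_on {0..} A" and t: "t \<ge> 0"
  shows "((\<lambda>t. mode N \<alpha> A t x y) has_vector_derivative
    (complex_of_real (A t * x) + \<alpha> / fact N * frequency A t y ^ N) * mode N \<alpha> A t x y) (at t within {0..})"
proof -
  have "((\<lambda>t. phase N A t y) has_vector_derivative frequency A t y ^ N) (at t within {0..})"
    unfolding phase_def using A t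
    by (intro primitive_has_vector_derivative continuous_intros continuous_on_frequency)
  moreover have "(drift A has_real_derivative A t) (at t within {0..})"
    using drift_has_vector_derivative[OF A t] by (simp add: has_real_derivative_iff_has_vector_derivative)
  ultimately have "((\<lambda>t. frequency A t y * complex_of_real x + \<alpha> / fact N * phase N A t y) has_vector_derivative
      complex_of_real (A t * x) + \<alpha> / fact N * frequency A t y ^ N) (at t within {0..})"
    unfolding frequency_def[of A t for t]
    by (auto intro!: derivative_eq_intros)
  then have "(exp \<circ> (\<lambda>t. frequency A t y * complex_of_real x + \<alpha> / fact N * phase N A t y) has_vector_derivative
      (complex_of_real (A t * x) + \<alpha> / fact N * frequency A t y ^ N) * mode N \<alpha> A t x y) (at t within {0..})"
    by (rule field_vector_diff_chain_within) (simp add: mode_def has_field_derivative_at_within[OF DERIV_exp])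
  then show ?thesis
    by (simp add: comp_def mode_def)
qed

context compactly_supported_complex_measure
begin

lemma continuous_on_superposition:
  assumes A: "continuous_on {0..} A"
  shows "continuous_on ({0..} \<times> UNIV)
    (\<lambda>(t, x). complex_measure_integral \<mu> (\<lambda>y. frequency A t y ^ j * mode N \<alpha> A t x y))"
  using continuous_parameter_integral[OF _ continuous_on_mode[OF A, where j = j and N = N and \<alpha> = \<alpha>]]
  by (simp add: closed_Times case_prod_beta)

lemma continuous_on_mode_section:
  assumes "continuous_on {0..} A" "t \<ge> 0"
  shows "continuous_on UNIV (\<lambda>y. frequency A t y ^ j * mode N \<alpha> A t x y)"
  using assms by (intro continuous_on_mode_compose continuous_intros) auto

lemma superposition_space_derivative:
  assumes A: "continuous_on {0..} A" and t: "t \<ge> 0"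
  shows "((\<lambda>x. complex_measure_integral \<mu> (\<lambda>y. frequency A t y ^ j * mode N \<alpha> A t x y)) has_vector_derivative
    complex_measure_integral \<mu> (\<lambda>y. frequency A t y ^ Suc j * mode N \<alpha> A t x y)) (at x)"
proof (rule has_vector_derivative_parameter_integral[of UNIV])
  show "continuous_on (UNIV \<times> UNIV) (\<lambda>(x, y). frequency A t y ^ Suc j * mode N \<alpha> A t x y)"
    unfolding case_prod_beta using t by (intro continuous_on_mode_compose A continuous_intros) auto
qed (use mode_space_derivative continuous_on_mode_section[OF assms] in auto)

lemma superposition_time_derivative:
  assumes A: "continuous_on {0..} A" and t: "t \<ge> 0"
  shows "((\<lambda>t. complex_measure_integral \<mu> (\<lambda>y. mode N \<alpha> A t x y)) has_vector_derivative
    \<alpha> / fact N * complex_measure_integral \<mu> (\<lambda>y. frequency A t y ^ N * mode N \<alpha> A t x y) +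
    complex_of_real (A t * x) * complex_measure_integral \<mu> (\<lambda>y. mode N \<alpha> A t x y)) (at t within {0..})"
proof -
  have sec: "continuous_on UNIV (\<lambda>y. mode N \<alpha> A s x y)" if "s \<ge> 0" for s
    using continuous_on_mode_section[OF A that, of 0] by simp
  have "((\<lambda>t. complex_measure_integral \<mu> (\<lambda>y. mode N \<alpha> A t x y)) has_vector_derivative
      complex_measure_integral \<mu> (\<lambda>y. (complex_of_real (A t * x) + \<alpha> / fact N * frequency A t y ^ N) *
        mode N \<alpha> A t x y)) (at t within {0..})"
  proof (rule has_vector_derivative_parameter_integral[of "{0..}"])
    let ?S = "{0..} \<times> UNIV :: (real \<times> real) set"
    have F: "continuous_on ?S (\<lambda>q. frequency A (fst q) (snd q) ^ j * mode N \<alpha> A (fst q) x (snd q))" for j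
      by (intro continuous_on_mode_compose A continuous_intros) auto
    have "continuous_on ?S (\<lambda>q. A (fst q))"
      by (rule continuous_on_compose2[OF A]) (auto intro!: continuous_intros)
    then have "continuous_on ?S (\<lambda>q. complex_of_real (A (fst q) * x) *
          (frequency A (fst q) (snd q) ^ 0 * mode N \<alpha> A (fst q) x (snd q)) +
        \<alpha> / fact N * (frequency A (fst q) (snd q) ^ N * mode N \<alpha> A (fst q) x (snd q)))"
      by (intro continuous_intros F)
    then show "continuous_on ?S (\<lambda>(t, y). (complex_of_real (A t * x) + \<alpha> / fact N * frequency A t y ^ N) *
        mode N \<alpha> A t x y)"
      by (simp add: case_prod_beta algebra_simps)
  qed (use sec t mode_time_derivative[OF A] in auto)
  also have "complex_measure_integral \<mu> (\<lambda>y. (complex_of_real (A t * x) + \<alpha> / fact N * frequency A t y ^ N) *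
        mode N \<alpha> A t x y) =
      complex_measure_integral \<mu> (\<lambda>y. \<alpha> / fact N * (frequency A t y ^ N * mode N \<alpha> A t x y) +
        complex_of_real (A t * x) * mode N \<alpha> A t x y)"
    by (rule arg_cong[where f = "complex_measure_integral \<mu>"]) (simp add: algebra_simps fun_eq_iff)
  also have "\<dots> = \<alpha> / fact N * complex_measure_integral \<mu> (\<lambda>y. frequency A t y ^ N * mode N \<alpha> A t x y) +
      complex_of_real (A t * x) * complex_measure_integral \<mu> (\<lambda>y. mode N \<alpha> A t x y)"
    using sec[OF t] continuous_on_mode_section[OF A t, of N]
    unfolding complex_measure_integral_mult_left[symmetric] by (intro integral_add continuous_on_mult_left)
  finally show ?thesis .
qed

lemma classical_solution_superposition:
  assumes A: "continuous_on {0..} A"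
    and f: "\<And>x. f x = fourier_extension \<mu> (complex_of_real x)"
  shows "classical_solution N \<alpha> A f (\<lambda>t x. complex_measure_integral \<mu> (\<lambda>y. mode N \<alpha> A t x y))"
proof -
  define Dx where "Dx j t x = complex_measure_integral \<mu> (\<lambda>y. frequency A t y ^ j * mode N \<alpha> A t x y)" for j t x
  define Dt where "Dt t x = \<alpha> / fact N * Dx N t x + complex_of_real (A t * x) * Dx 0 t x" for t x
  have Dx: "continuous_on ({0..} \<times> UNIV) (\<lambda>(t, x). Dx j t x)" for j
    unfolding Dx_def using A by (rule continuous_on_superposition)
  have "continuous_on ({0..} \<times> UNIV) (\<lambda>p :: real \<times> real. A (fst p))"
    by (rule continuous_on_compose2[OF A]) (auto intro!: continuous_intros)
  then have Dt: "continuous_on ({0..} \<times> UNIV) (\<lambda>(t, x). Dt t x)"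
    unfolding Dt_def using Dx unfolding case_prod_beta by (intro continuous_intros) auto
  have "classical_solution N \<alpha> A f (Dx 0)"
    unfolding classical_solution_def
  proof (rule exI[of _ Dt], rule exI[of _ Dx], intro conjI allI impI)
    show "(Dx j t has_vector_derivative Dx (Suc j) t x) (at x)" if "t \<ge> 0" for j t x
      unfolding Dx_def using A that by (rule superposition_space_derivative)
    show "((\<lambda>t. Dx 0 t x) has_vector_derivative Dt t x) (at t within {0..})" if "t \<ge> 0" for t x
      using superposition_time_derivative[OF A that] by (simp add: Dx_def Dt_def)
    show "Dx 0 0 x = f x" for x
      by (simp add: f fourier_extension_def Dx_def mode_def frequency_def phase_def drift_def)
  qed (rule Dt Dx refl Dt_def)+
  then show ?thesis
    by (simp add: Dx_def[abs_def])
qed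

end

section \<open>Products of factors close to 1\<close>

lemma tendsto_floor_mult_div:
  fixes t :: real
  assumes "t \<ge> 0"
  shows "(\<lambda>n. real (nat \<lfloor>real n * t\<rfloor>) / real n) \<longlonglongrightarrow> t"
proof (rule tendsto_sandwich)
  show "(\<lambda>n. t - 1 / real n) \<longlonglongrightarrow> t"
    by real_asymp
  show "\<forall>\<^sub>F n in sequentially. t - 1 / real n \<le> real (nat \<lfloor>real n * t\<rfloor>) / real n"
    using eventually_gt_at_top[of 0]
  proof eventually_elim
    case (elim n)
    have "real n * t - 1 \<le> real (nat \<lfloor>real n * t\<rfloor>)"
      using assms by linarith
    then have "(real n * t - 1) / real n \<le> real (nat \<lfloor>real n * t\<rfloor>) / real n"
      by (rule divide_right_mono) simp
    then show ?case
      using elim by (simp add: diff_divide_distrib)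
  qed
  show "\<forall>\<^sub>F n in sequentially. real (nat \<lfloor>real n * t\<rfloor>) / real n \<le> t"
    using eventually_gt_at_top[of 0]
  proof eventually_elim
    case (elim n)
    have "real (nat \<lfloor>real n * t\<rfloor>) \<le> real n * t"
      using assms by (simp add: of_nat_nat)
    then show ?case
      using elim by (simp add: field_simps)
  qed
qed auto

lemma grid_point_le:
  fixes t :: real
  assumes "k \<in> {1..nat \<lfloor>real n * t\<rfloor>}"
  shows "n > 0" "0 \<le> real k / real n" "real k / real n \<le> t"
proof -
  have "n \<noteq> 0"
    using assms by (cases "n = 0") auto
  moreover have "real k \<le> real n * t"
  proof -
    have "1 \<le> k" "k \<le> nat \<lfloor>real n * t\<rfloor>"
      using assms by auto
    then show ?thesis
      by linarith
  qed
  ultimately show "n > 0" "0 \<le> real k / real n" "real k / real n \<le> t"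
    by (auto simp: field_simps)
qed

lemma card_grid_le:
  fixes t :: real
  assumes "t \<ge> 0"
  shows "real (card {1..nat \<lfloor>real n * t\<rfloor>}) \<le> real n * t"
  using assms by (simp add: of_nat_nat)

text \<open>The sum is compared with the telescoping sum of a primitive \<open>F\<close> over the grid.  On one cell
  the mean value inequality and the uniform continuity of \<open>f\<close> bound the difference by \<open>\<epsilon> / n\<close>, and there are at
  most \<open>n t\<close> cells; the incomplete last cell vanishes in the limit by the continuity of \<open>F\<close>.\<close>

lemma Riemann_sum_right_endpoints:
  fixes f :: "real \<Rightarrow> 'b::banach"
  assumes f: "continuous_on {0..t} f" and t: "t \<ge> 0"
  shows "(\<lambda>n. \<Sum>k = 1..nat \<lfloor>real n * t\<rfloor>. (1 / real n) *\<^sub>R f (real k / real n)) \<longlonglongrightarrow> integral {0..t} f"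
proof -
  define F where "F s = integral {0..s} f" for s
  define m where "m n = nat \<lfloor>real n * t\<rfloor>" for n
  define S where "S n = (\<Sum>k = 1..m n. (1 / real n) *\<^sub>R f (real k / real n))" for n
  have F': "(F has_vector_derivative f s) (at s within {0..t})" if "s \<in> {0..t}" for s
    unfolding F_def using f that by (rule integral_has_vector_derivative)
  have "continuous_on {0..t} F"
    by (rule continuous_on_vector_derivative) (rule F')
  have grid: "real j / real n \<in> {0..t}" if "j \<le> m n" "n > 0" for j n
    using grid_point_le[of j n t] that t by (cases "j = 0") (auto simp: m_def)
  have "(\<lambda>n. F (real (m n) / real n)) \<longlonglongrightarrow> F t"
  proof (rule continuous_on_tendsto_compose[OF \<open>continuous_on {0..t} F\<close>])
    show "(\<lambda>n. real (m n) / real n) \<longlonglongrightarrow> t"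
      unfolding m_def using t by (rule tendsto_floor_mult_div)
    show "\<forall>\<^sub>F n in sequentially. real (m n) / real n \<in> {0..t}"
      using eventually_gt_at_top[of 0] by eventually_elim (rule grid, auto)
  qed (use t in auto)
  moreover have "(\<lambda>n. F (real (m n) / real n) - S n) \<longlonglongrightarrow> 0"
  proof (rule tendstoI)
    fix e :: real assume "e > 0"
    \<comment> \<open>The shift by 1 covers \<open>t = 0\<close> and makes the final estimate \<open>t * \<epsilon> < e\<close> strict.\<close>
    define \<epsilon> where "\<epsilon> = e / (t + 1)"
    have "\<epsilon> > 0"
      using \<open>e > 0\<close> t by (simp add: \<epsilon>_def)
    have "uniformly_continuous_on {0..t} f"
      using f by (rule compact_uniformly_continuous) simp
    then obtain d where d: "d > 0"
      "\<And>x x'. x \<in> {0..t} \<Longrightarrow> x' \<in> {0..t} \<Longrightarrow> dist x' x < d \<Longrightarrow> dist (f x') (f x) < \<epsilon>"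
      using \<open>\<epsilon> > 0\<close> unfolding uniformly_continuous_on_def by metis
    have "\<forall>\<^sub>F n in sequentially. 1 / real n < d"
      using d(1) by real_asymp
    then show "\<forall>\<^sub>F n in sequentially. dist (F (real (m n) / real n) - S n) 0 < e"
      using eventually_gt_at_top[of 0]
    proof eventually_elim
      case (elim n)
      have cell: "norm (F (real k / real n) - F (real (k - 1) / real n) - (1 / real n) *\<^sub>R f (real k / real n))
          \<le> \<epsilon> / real n" if k: "k \<in> {1..m n}" for k
      proof -
        let ?I = "{real (k - 1) / real n .. real k / real n}"
        have sub: "?I \<subseteq> {0..t}"
          using grid[of "k - 1" n] grid[of k n] k elim(2) by auto
        have len: "real k / real n - real (k - 1) / real n = 1 / real n"
          using k elim(2) by (simp add: field_simps of_nat_diff)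
        then have le: "real (k - 1) / real n \<le> real k / real n"
          by (smt (verit) divide_nonneg_nonneg of_nat_0_le_iff)
        have "norm (F (real k / real n) - F (real (k - 1) / real n)
            - (real k / real n - real (k - 1) / real n) *\<^sub>R f (real k / real n))
            \<le> norm (real k / real n - real (k - 1) / real n) * \<epsilon>"
        proof (rule vector_differentiable_bound_linearization)
          show "(F has_vector_derivative f x) (at x within ?I)" if "x \<in> ?I" for x
            using F'[of x] that sub by (blast intro: has_vector_derivative_within_subset)
          show "closed_segment (real (k - 1) / real n) (real k / real n) \<subseteq> ?I"
            using le by (simp add: closed_segment_eq_real_ivl)
          show "norm (f x - f (real k / real n)) \<le> \<epsilon>" if "x \<in> ?I" for x
          proof -
            have "dist x (real k / real n) < d"
              using that len elim(1) by (auto simp: dist_real_def)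
            then show ?thesis
              using d(2)[of "real k / real n" x] subsetD[OF sub that] grid[of k n] k elim(2)
              by (simp add: dist_norm less_imp_le)
          qed
          show "real k / real n \<in> ?I"
            using le by simp
        qed
        then show ?thesis
          unfolding len by simp
      qed
      have "F (real (m n) / real n) = (\<Sum>k = 1..m n. F (real k / real n) - F (real (k - 1) / real n))"
        using sum_telescope''[of 0 "m n" "\<lambda>k. F (real k / real n)"] by (simp add: F_def)
      then have "F (real (m n) / real n) - S n
          = (\<Sum>k = 1..m n. F (real k / real n) - F (real (k - 1) / real n) - (1 / real n) *\<^sub>R f (real k / real n))"
        by (simp add: S_def sum_subtractf)
      also have "norm \<dots> \<le> (\<Sum>k = 1..m n. \<epsilon> / real n)"
        by (rule sum_norm_le) (rule cell)
      also have "\<dots> = real (card {1..m n}) * (\<epsilon> / real n)"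
        by simp
      also have "\<dots> \<le> (real n * t) * (\<epsilon> / real n)"
        unfolding m_def using card_grid_le[OF t, of n] \<open>\<epsilon> > 0\<close> by (intro mult_right_mono) auto
      also have "\<dots> = t * \<epsilon>"
        using elim(2) by simp
      also have "\<dots> < e"
        using \<open>e > 0\<close> t by (simp add: \<epsilon>_def field_simps)
      finally show ?case
        by simp
    qed
  qed
  ultimately have "(\<lambda>n. F (real (m n) / real n) - (F (real (m n) / real n) - S n)) \<longlonglongrightarrow> F t - 0"
    by (rule tendsto_diff)
  then show ?thesis
    by (simp add: S_def m_def F_def)
qed

text \<open>The factors are exchanged one at a time.  Below, \<open>K\<close> is \<open>e\<close> to the power \<open>O(1/n)\<close> for \<open>O(n)\<close>
  factors, so that \<open>K ^ card I\<close> remains bounded.\<close>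

lemma norm_prod_diff_le:
  fixes z w :: "'i \<Rightarrow> 'a::{real_normed_algebra_1, comm_monoid_mult}"
  assumes "K \<ge> 1" and "\<And>i. i \<in> I \<Longrightarrow> norm (z i) \<le> K" "\<And>i. i \<in> I \<Longrightarrow> norm (w i) \<le> K"
  shows "norm (prod z I - prod w I) \<le> K ^ card I * (\<Sum>i\<in>I. norm (z i - w i))"
  using assms(2,3)
proof (induction I rule: infinite_finite_induct)
  case (insert i I)
  have "norm (prod w I) \<le> (\<Prod>i\<in>I. norm (w i))"
    by (rule norm_prod_le)
  also have "\<dots> \<le> (\<Prod>i\<in>I. K)"
    using insert.prems by (intro prod_mono) auto
  finally have w: "norm (prod w I) \<le> K ^ card I"
    by simp
  have "z i * prod z I - w i * prod w I = z i * (prod z I - prod w I) + (z i - w i) * prod w I"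
    by (simp add: algebra_simps)
  also have "norm \<dots> \<le> norm (z i) * norm (prod z I - prod w I) + norm (z i - w i) * norm (prod w I)"
    by (intro order_trans[OF norm_triangle_ineq] add_mono norm_mult_ineq)
  also have "\<dots> \<le> K * (K ^ card I * (\<Sum>i\<in>I. norm (z i - w i))) + norm (z i - w i) * K ^ card I"
    using insert assms(1) w by (intro add_mono mult_mono) auto
  also have "\<dots> \<le> K * (K ^ card I * (\<Sum>i\<in>I. norm (z i - w i))) + norm (z i - w i) * (K * K ^ card I)"
    using assms(1) by (intro add_left_mono mult_left_mono) auto
  also have "\<dots> = K ^ card (insert i I) * (\<Sum>i\<in>insert i I. norm (z i - w i))"
    using insert.hyps by (simp add: algebra_simps)
  finally show ?case
    using insert.hyps by simp
qed auto

lemma root_power_scale: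
  assumes "N > 0" "n > 0"
  shows "(real n powr (- 1 / real N)) ^ N = 1 / real n" "real n powr (- 1 / real N) \<le> 1"
proof -
  have "(real n powr (- 1 / real N)) ^ N = real n powr (real N * (- 1 / real N))"
    using assms by (simp add: powr_power)
  also have "\<dots> = 1 / real n"
    using assms by (simp add: powr_minus field_simps)
  finally show "(real n powr (- 1 / real N)) ^ N = 1 / real n" .
  show "real n powr (- 1 / real N) \<le> 1"
    using assms powr_mono[of "- 1 / real N" 0 "real n"] by simp
qed

text \<open>The only property of the moment generating function of a step that the limit depends on: its
  expansion has no power between \<open>1\<close> and \<open>z ^ N\<close>, with a remainder controlled on a disc that contains all the
  arguments that occur.\<close>

locale order_N_germ =
  fixes \<phi> :: "complex \<Rightarrow> complex" and N :: nat and c :: complex and L C :: real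
  assumes N: "N > 0" and L: "L \<ge> 0" and C: "C \<ge> 0"
    and remainder: "\<And>z. norm z \<le> L \<Longrightarrow> norm (\<phi> z - (1 + c * z ^ N)) \<le> C * norm z ^ Suc N"
begin

text \<open>The logarithmic growth rate of the products: a factor is at most \<open>exp (growth / n)\<close>.\<close>

definition growth :: real where
  "growth = norm c * L ^ N + C * L ^ Suc N"

lemma growth_nonneg: "growth \<ge> 0" "norm c * L ^ N \<le> growth"
  using L C by (auto simp: growth_def)

text \<open>The scale \<open>h\<close>, which is \<open>n\<close> to the power \<open>-1/N\<close>, satisfies \<open>h ^ N = 1 / n\<close>.  This turns the leading term
  into \<open>c z\<^sup>N / n\<close> and the remainder of order \<open>N + 1\<close> into \<open>h / n\<close>, which is \<open>o(1/n)\<close>.\<close>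

lemma scaled_remainder:
  assumes "norm z \<le> L" "n > 0"
  shows "norm (\<phi> (complex_of_real (real n powr (- 1 / real N)) * z) - (1 + c * z ^ N / of_nat n))
    \<le> C * L ^ Suc N * (real n powr (- 1 / real N) / real n)"
proof -
  define h where "h = real n powr (- 1 / real N)"
  have h: "h ^ N = 1 / real n" "0 \<le> h" "h \<le> 1"
    using root_power_scale[OF N assms(2)] by (auto simp: h_def)
  have small: "norm (complex_of_real h * z) \<le> h * L"
    using assms h by (simp add: norm_mult mult_left_mono)
  also have "\<dots> \<le> L"
    using h L by (simp add: mult_left_le_one_le)
  finally have "norm (\<phi> (complex_of_real h * z) - (1 + c * (complex_of_real h * z) ^ N))
      \<le> C * norm (complex_of_real h * z) ^ Suc N"
    by (rule remainder)
  also have "\<dots> \<le> C * (h * L) ^ Suc N"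
    by (intro mult_left_mono power_mono small C) auto
  also have "\<dots> = C * L ^ Suc N * (h * h ^ N)"
    by (simp add: power_mult_distrib)
  also have "\<dots> = C * L ^ Suc N * (h / real n)"
    by (simp add: h(1))
  finally show ?thesis
    unfolding h_def[symmetric]
    by (simp add: power_mult_distrib of_real_power[symmetric] h(1) del: of_real_power)
qed

lemma norm_scaled_le:
  assumes "norm z \<le> L" "n > 0"
  shows "norm (\<phi> (complex_of_real (real n powr (- 1 / real N)) * z)) \<le> exp (growth / real n)"
proof -
  have "norm (\<phi> (complex_of_real (real n powr (- 1 / real N)) * z))
      \<le> norm (1 + c * z ^ N / of_nat n) + C * L ^ Suc N * (real n powr (- 1 / real N) / real n)"
    using scaled_remainder[OF assms] norm_triangle_sub order_trans add_left_mono by (smt (verit))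
  also have "norm (1 + c * z ^ N / of_nat n) \<le> 1 + norm c * L ^ N / real n"
  proof -
    have "norm (c * z ^ N / of_nat n) \<le> norm c * L ^ N / real n"
      using assms by (simp add: norm_mult norm_divide norm_power divide_right_mono mult_left_mono power_mono)
    then show ?thesis
      using norm_triangle_ineq[of 1 "c * z ^ N / of_nat n"] by simp
  qed
  also have "C * L ^ Suc N * (real n powr (- 1 / real N) / real n) \<le> C * L ^ Suc N * (1 / real n)"
    using root_power_scale(2)[OF N assms(2)] C L by (intro mult_left_mono divide_right_mono) auto
  also have "1 + norm c * L ^ N / real n + C * L ^ Suc N * (1 / real n) = 1 + growth / real n"
    by (simp add: growth_def add_divide_distrib)
  also have "\<dots> \<le> exp (growth / real n)"
    by (rule exp_ge_add_one_self)
  finally show ?thesis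
    by simp
qed

lemma exp_power_card_le:
  fixes t :: real
  assumes "t \<ge> 0"
  shows "exp (growth / real n) ^ card {1..nat \<lfloor>real n * t\<rfloor>} \<le> exp (growth * t)"
proof -
  have "exp (growth / real n) ^ card {1..nat \<lfloor>real n * t\<rfloor>} = exp (real (card {1..nat \<lfloor>real n * t\<rfloor>}) * (growth / real n))"
    by (rule exp_of_nat_mult[symmetric])
  also have "\<dots> \<le> exp (real n * t * (growth / real n))"
    unfolding exp_le_cancel_iff
    using growth_nonneg card_grid_le[OF assms, of n] by (intro mult_right_mono) auto
  also have "\<dots> \<le> exp (growth * t)"
    unfolding exp_le_cancel_iff using growth_nonneg assms by (cases "n = 0") auto
  finally show ?thesis .
qed

lemma norm_prod_scaled_le:
  fixes t :: real
  assumes t: "t \<ge> 0" and g: "\<And>s. s \<in> {0..t} \<Longrightarrow> norm (g s) \<le> L"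
  shows "norm (\<Prod>k = 1..nat \<lfloor>real n * t\<rfloor>. \<phi> (complex_of_real (real n powr (- 1 / real N)) * g (real k / real n)))
    \<le> exp (growth * t)"
proof -
  let ?f = "\<lambda>k. \<phi> (complex_of_real (real n powr (- 1 / real N)) * g (real k / real n))"
  have "norm (prod ?f {1..nat \<lfloor>real n * t\<rfloor>}) = (\<Prod>k = 1..nat \<lfloor>real n * t\<rfloor>. norm (?f k))"
    by (rule prod_norm[symmetric])
  also have "\<dots> \<le> (\<Prod>k = 1..nat \<lfloor>real n * t\<rfloor>. exp (growth / real n))"
    using grid_point_le[of _ n t] by (intro prod_mono conjI norm_scaled_le g) auto
  also have "\<dots> \<le> exp (growth * t)"
    using exp_power_card_le[OF t, of n] by simp
  finally show ?thesis .
qed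

text \<open>Each factor differs from \<open>exp (c * g (k / n) ^ N / n)\<close> by at most \<open>\<delta> n = o(1/n)\<close>, so that the two
  products have the same limit; the product of the exponentials is the exponential of a Riemann sum.\<close>

lemma prod_scaled_tendsto:
  fixes t :: real
  assumes t: "t \<ge> 0" and cont: "continuous_on {0..t} g" and g: "\<And>s. s \<in> {0..t} \<Longrightarrow> norm (g s) \<le> L"
  shows "(\<lambda>n. \<Prod>k = 1..nat \<lfloor>real n * t\<rfloor>. \<phi> (complex_of_real (real n powr (- 1 / real N)) * g (real k / real n)))
    \<longlonglongrightarrow> exp (c * integral {0..t} (\<lambda>s. g s ^ N))"
proof -
  define I where "I n = {1..nat \<lfloor>real n * t\<rfloor>}" for n
  define V where "V = norm c * L ^ N"
  have V: "0 \<le> V"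
    using L by (simp add: V_def)
  define z where "z n k = \<phi> (complex_of_real (real n powr (- 1 / real N)) * g (real k / real n))" for n k
  define v where "v n k = c * g (real k / real n) ^ N / of_nat n" for n k
  define \<delta> where "\<delta> n = C * L ^ Suc N * (real n powr (- 1 / real N) / real n) + exp V * (V / real n) ^ 2" for n
  have grid: "n > 0" "norm (g (real k / real n)) \<le> L" if "k \<in> I n" for n k
    using that g[of "real k / real n"] grid_point_le[of k n t] by (auto simp: I_def)
  have v: "norm (v n k) \<le> V / real n" if "k \<in> I n" for n k
    using grid[OF that] unfolding v_def V_def
    by (simp add: norm_mult norm_divide norm_power divide_right_mono mult_left_mono power_mono)
  have factor: "norm (z n k - exp (v n k)) \<le> \<delta> n" if k: "k \<in> I n" for n k
  proof -
    have "V / real n \<le> V"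
      using V grid(1)[OF k] by (simp add: divide_le_eq mult_left_le_one_le mult_le_cancel_left1)
    have "norm (exp (v n k) - (1 + v n k)) \<le> exp (norm (v n k)) * norm (v n k) ^ 2"
      using Taylor_exp_field[of "v n k" 1] by (simp add: numeral_2_eq_2)
    also have "\<dots> \<le> exp V * (V / real n) ^ 2"
      using v[OF k] \<open>V / real n \<le> V\<close> by (intro mult_mono power_mono) auto
    finally have "norm (exp (v n k) - (1 + v n k)) \<le> exp V * (V / real n) ^ 2" .
    moreover have "norm (z n k - (1 + v n k)) \<le> C * L ^ Suc N * (real n powr (- 1 / real N) / real n)"
      unfolding z_def v_def using grid[OF k] by (intro scaled_remainder)
    ultimately show ?thesis
      unfolding \<delta>_def
      using norm_triangle_ineq4[of "z n k - (1 + v n k)" "exp (v n k) - (1 + v n k)"] by simp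
  qed
  have prods: "norm (prod (z n) (I n) - prod (\<lambda>k. exp (v n k)) (I n)) \<le> exp (growth * t) * (real n * t * \<delta> n)" for n
  proof -
    have exp_v: "norm (exp (v n k)) \<le> exp (growth / real n)" if "k \<in> I n" for k
    proof -
      have "norm (exp (v n k)) \<le> exp (norm (v n k))"
        by (rule norm_exp)
      also have "\<dots> \<le> exp (growth / real n)"
        using v[OF that] divide_right_mono[OF growth_nonneg(2), of "real n"] by (simp add: V_def)
      finally show ?thesis .
    qed
    have "norm (prod (z n) (I n) - prod (\<lambda>k. exp (v n k)) (I n))
        \<le> exp (growth / real n) ^ card (I n) * (\<Sum>k\<in>I n. norm (z n k - exp (v n k)))"
      using growth_nonneg exp_v grid norm_scaled_le unfolding z_def
      by (intro norm_prod_diff_le) auto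
    also have "\<dots> \<le> exp (growth * t) * (real n * t * \<delta> n)"
    proof (rule mult_mono)
      show "exp (growth / real n) ^ card (I n) \<le> exp (growth * t)"
        unfolding I_def using t by (rule exp_power_card_le)
      have "(\<Sum>k\<in>I n. norm (z n k - exp (v n k))) \<le> real (card (I n)) * \<delta> n"
        by (rule sum_bounded_above) (rule factor)
      also have "\<dots> \<le> real n * t * \<delta> n"
        unfolding I_def using card_grid_le[OF t, of n] C L
        by (intro mult_right_mono) (auto simp: \<delta>_def)
      finally show "(\<Sum>k\<in>I n. norm (z n k - exp (v n k))) \<le> real n * t * \<delta> n" .
    qed (auto intro: sum_nonneg)
    finally show ?thesis .
  qed
  have "(\<lambda>n. exp (growth * t) * (real n * t * \<delta> n)) \<longlonglongrightarrow> 0"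
  proof -
    have "(\<lambda>n. real n powr (- 1 / real N)) \<longlonglongrightarrow> 0"
      using N by (intro tendsto_neg_powr filterlim_real_sequentially) simp
    then have "(\<lambda>n. exp (growth * t) * (t * (C * L ^ Suc N * real n powr (- 1 / real N) + exp V * (V ^ 2 * inverse (real n)))))
        \<longlonglongrightarrow> exp (growth * t) * (t * (C * L ^ Suc N * 0 + exp V * (V ^ 2 * 0)))"
      by (intro tendsto_intros lim_inverse_n)
    then have "(\<lambda>n. exp (growth * t) * (t * (C * L ^ Suc N * real n powr (- 1 / real N) + exp V * (V ^ 2 * inverse (real n)))))
        \<longlonglongrightarrow> 0"
      by simp
    moreover have "\<forall>\<^sub>F n in sequentially.
        exp (growth * t) * (t * (C * L ^ Suc N * real n powr (- 1 / real N) + exp V * (V ^ 2 * inverse (real n))))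
        = exp (growth * t) * (real n * t * \<delta> n)"
      using eventually_gt_at_top[of 0]
      by eventually_elim (simp add: \<delta>_def field_simps power2_eq_square)
    ultimately show ?thesis
      by (rule Lim_transform_eventually)
  qed
  then have "(\<lambda>n. prod (z n) (I n) - prod (\<lambda>k. exp (v n k)) (I n)) \<longlonglongrightarrow> 0"
    by (rule Lim_null_comparison[rotated]) (simp add: prods)
  moreover have "(\<lambda>n. prod (\<lambda>k. exp (v n k)) (I n)) \<longlonglongrightarrow> exp (c * integral {0..t} (\<lambda>s. g s ^ N))"
  proof -
    have "(\<lambda>n. \<Sum>k\<in>I n. (1 / real n) *\<^sub>R g (real k / real n) ^ N) \<longlonglongrightarrow> integral {0..t} (\<lambda>s. g s ^ N)"
      unfolding I_def using cont t by (intro Riemann_sum_right_endpoints continuous_intros)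
    then have "(\<lambda>n. exp (c * (\<Sum>k\<in>I n. (1 / real n) *\<^sub>R g (real k / real n) ^ N)))
        \<longlonglongrightarrow> exp (c * integral {0..t} (\<lambda>s. g s ^ N))"
      by (intro tendsto_intros)
    also have "(\<lambda>n. exp (c * (\<Sum>k\<in>I n. (1 / real n) *\<^sub>R g (real k / real n) ^ N)))
        = (\<lambda>n. prod (\<lambda>k. exp (v n k)) (I n))"
      by (simp add: v_def I_def exp_sum sum_distrib_left scaleR_conv_of_real)
    finally show ?thesis .
  qed
  ultimately have "(\<lambda>n. (prod (z n) (I n) - prod (\<lambda>k. exp (v n k)) (I n)) + prod (\<lambda>k. exp (v n k)) (I n))
      \<longlonglongrightarrow> 0 + exp (c * integral {0..t} (\<lambda>s. g s ^ N))"
    by (rule tendsto_add)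
  then show ?thesis
    by (simp add: z_def I_def)
qed

end

section \<open>The moment generating function of a step\<close>

definition rotated_root :: "nat \<Rightarrow> complex \<Rightarrow> nat \<Rightarrow> complex" where
  "rotated_root N r k = r * exp (2 * complex_of_real pi * \<i> * of_nat k / of_nat N)"

definition step_mgf :: "nat \<Rightarrow> complex \<Rightarrow> complex \<Rightarrow> complex" where
  "step_mgf N r z = (\<Sum>k<N. exp (rotated_root N r k * z)) / of_nat N"

text \<open>The \<open>j\<close>-th powers of the \<open>N\<close>-th roots of unity form a geometric progression whose ratio \<open>w\<close> satisfies
  \<open>w \<noteq> 1\<close> and \<open>w ^ N = 1\<close>.  This is why the moments of a step below order \<open>N\<close> vanish.\<close>

lemma sum_rotated_root_power:
  assumes N: "N > 0" and j: "0 < j" "j < N"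
  shows "(\<Sum>k<N. rotated_root N r k ^ j) = 0"
proof -
  define w where "w = exp (2 * complex_of_real pi * \<i> * of_nat j / of_nat N)"
  have "rotated_root N r k ^ j = r ^ j * w ^ k" for k
    by (simp add: rotated_root_def w_def power_mult_distrib exp_of_nat_mult[symmetric] mult_ac)
  moreover have "(\<Sum>k<N. w ^ k) = 0"
  proof -
    have "w ^ N = 1"
      using N complex_root_unity[of N j] by (simp add: w_def)
    moreover have "w \<noteq> 1"
      using complex_root_unity_eq_1[of N j] N j by (auto simp: w_def dest: dvd_imp_le)
    ultimately show ?thesis
      by (simp add: geometric_sum)
  qed
  ultimately show ?thesis
    by (simp add: sum_distrib_left[symmetric])
qed

lemma rotated_root_power: "N > 0 \<Longrightarrow> rotated_root N r k ^ N = r ^ N"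
  by (simp add: rotated_root_def power_mult_distrib complex_root_unity)

lemma norm_rotated_root [simp]: "norm (rotated_root N r k) = norm r"
proof -
  have "norm (exp (2 * complex_of_real pi * \<i> * of_nat k / of_nat N)) = 1"
    by (simp add: norm_exp_eq_Re Re_divide_of_nat)
  then show ?thesis
    by (simp add: rotated_root_def norm_mult)
qed

lemma step_mgf_Taylor:
  assumes N: "N > 0"
  shows "norm (step_mgf N r z - (1 + r ^ N / fact N * z ^ N))
    \<le> exp (norm r * norm z) * (norm r * norm z) ^ Suc N / fact N"
proof -
  let ?\<rho> = "rotated_root N r"
  define E where "E k = exp (?\<rho> k * z) - (\<Sum>j\<le>N. (?\<rho> k * z) ^ j / fact j)" for k
  have "(\<Sum>k<N. \<Sum>j\<le>N. (?\<rho> k * z) ^ j / fact j) = (\<Sum>j\<le>N. (\<Sum>k<N. ?\<rho> k ^ j) * z ^ j / fact j)"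
    by (subst sum.swap) (simp add: power_mult_distrib sum_distrib_right sum_divide_distrib)
  also have "\<dots> = (\<Sum>j\<in>{0, N}. (\<Sum>k<N. ?\<rho> k ^ j) * z ^ j / fact j)"
    using N by (intro sum.mono_neutral_right) (auto simp: sum_rotated_root_power)
  also have "\<dots> = of_nat N * (1 + r ^ N / fact N * z ^ N)"
    using N by (simp add: rotated_root_power algebra_simps)
  finally have "step_mgf N r z - (1 + r ^ N / fact N * z ^ N) = (\<Sum>k<N. E k) / of_nat N"
    using N by (simp add: step_mgf_def E_def sum_subtractf diff_divide_distrib)
  also have "norm \<dots> = norm (\<Sum>k<N. E k) / real N"
    by (simp add: norm_divide)
  also have "\<dots> \<le> (\<Sum>k<N. exp (norm r * norm z) * (norm r * norm z) ^ Suc N / fact N) / real N"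
  proof (intro divide_right_mono sum_norm_le)
    fix k
    show "norm (E k) \<le> exp (norm r * norm z) * (norm r * norm z) ^ Suc N / fact N"
      using Taylor_exp_field[of "?\<rho> k * z" N] by (simp add: E_def norm_mult)
  qed auto
  also have "\<dots> = exp (norm r * norm z) * (norm r * norm z) ^ Suc N / fact N"
    using N by simp
  finally show ?thesis .
qed

lemma step_mgf_germ:
  assumes N: "N > 0" and L: "L \<ge> 0"
  shows "order_N_germ (step_mgf N r) N (r ^ N / fact N) L (exp (norm r * L) * norm r ^ Suc N / fact N)"
proof
  fix z :: complex assume z: "norm z \<le> L"
  have "norm (step_mgf N r z - (1 + r ^ N / fact N * z ^ N))
      \<le> exp (norm r * norm z) * (norm r * norm z) ^ Suc N / fact N"
    using N by (rule step_mgf_Taylor)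
  also have "\<dots> \<le> exp (norm r * L) * (norm r * norm z) ^ Suc N / fact N"
    using z by (intro divide_right_mono mult_right_mono) (auto simp: mult_left_mono)
  also have "\<dots> = exp (norm r * L) * norm r ^ Suc N / fact N * norm z ^ Suc N"
    by (simp add: power_mult_distrib)
  finally show "norm (step_mgf N r z - (1 + r ^ N / fact N * z ^ N))
      \<le> exp (norm r * L) * norm r ^ Suc N / fact N * norm z ^ Suc N" .
qed (use N L in auto)

section \<open>The random walk\<close>

lemma has_integral_time_reversed:
  fixes f :: "real \<Rightarrow> 'b::banach"
  assumes f: "continuous_on {0..} f" and a: "a \<le> t"
  shows "((\<lambda>s. f (t - s)) has_integral integral {0..t - a} f) {a..t}"
proof -
  have "(f has_integral integral {0..t - a} f) (cbox 0 (t - a))"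
    using continuous_on_subset[OF f, of "{0..t - a}"] by (auto intro!: integrable_integral integrable_continuous_real)
  from has_integral_affinity[OF this, of "-1" t]
  have "((\<lambda>s. f (t - s)) has_integral integral {0..t - a} f) ((\<lambda>s. t - s) ` {0..t - a})"
    by (simp add: add.commute)
  also have "(\<lambda>s. t - s) ` {0..t - a} = {a..t}"
    using a by (simp add: image_diff_atLeastAtMost)
  finally show ?thesis .
qed

text \<open>The step \<open>\<xi> k\<close> contributes to the walk exactly at the times \<open>s \<ge> k / n\<close>, and the integral of \<open>A (t - s)\<close>
  over \<open>[k / n, t]\<close> is \<open>drift A (t - k / n)\<close>.\<close>

lemma integral_walk:
  fixes A :: "real \<Rightarrow> real" and \<xi> :: "nat \<Rightarrow> 'a \<Rightarrow> complex"
  assumes A: "continuous_on {0..} A" and t: "t \<ge> 0"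
  shows "integral {0..t} (\<lambda>s. complex_of_real (A (t - s)) * (walk N \<xi> n s \<omega> + complex_of_real x))
    = complex_of_real (drift A t) * complex_of_real x +
      (\<Sum>k = 1..nat \<lfloor>real n * t\<rfloor>. \<xi> k \<omega> * (complex_of_real (real n powr (- 1 / real N)) *
        complex_of_real (drift A (t - real k / real n))))"
proof -
  define h where "h = complex_of_real (real n powr (- 1 / real N))"
  let ?m = "nat \<lfloor>real n * t\<rfloor>"
  have reversed: "((\<lambda>s. complex_of_real (A (t - s))) has_integral complex_of_real (drift A (t - a))) {a..t}"
    if "a \<le> t" for a
    unfolding drift_def using has_integral_time_reversed[OF A that] by (rule has_integral_of_real)
  have jump: "((\<lambda>s. if s \<in> {real k / real n..t} then complex_of_real (A (t - s)) else 0) has_integral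
      complex_of_real (drift A (t - real k / real n))) {0..t}" if "k \<in> {1..?m}" for k
    using grid_point_le[OF that] reversed by (subst has_integral_restrict) auto
  have "((\<lambda>s. complex_of_real (A (t - s)) * complex_of_real x +
        (\<Sum>k = 1..?m. (\<xi> k \<omega> * h) * (if s \<in> {real k / real n..t} then complex_of_real (A (t - s)) else 0)))
      has_integral complex_of_real (drift A t) * complex_of_real x +
        (\<Sum>k = 1..?m. (\<xi> k \<omega> * h) * complex_of_real (drift A (t - real k / real n)))) {0..t}"
    using reversed[of 0] t jump
    by (intro has_integral_add has_integral_mult_left has_integral_sum has_integral_mult_right) auto
  moreover have "complex_of_real (A (t - s)) * (walk N \<xi> n s \<omega> + complex_of_real x) =
      complex_of_real (A (t - s)) * complex_of_real x +
        (\<Sum>k = 1..?m. (\<xi> k \<omega> * h) * (if s \<in> {real k / real n..t} then complex_of_real (A (t - s)) else 0))"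
    if s: "s \<in> {0..t}" for s
  proof -
    have "{1..nat \<lfloor>real n * s\<rfloor>} = {k \<in> {1..?m}. real k / real n \<le> s}"
    proof (cases "n = 0")
      case False
      have "real n * s \<le> real n * t"
        using s by (simp add: mult_left_mono)
      moreover have "real k / real n \<le> s \<longleftrightarrow> real k \<le> real n * s" for k
        using False by (simp add: field_simps)
      moreover have "k \<le> nat \<lfloor>real n * s\<rfloor> \<longleftrightarrow> real k \<le> real n * s" for k
        using s by (simp add: le_nat_iff le_floor_iff)
      moreover have "k \<le> ?m \<longleftrightarrow> real k \<le> real n * t" for k
        using t by (simp add: le_nat_iff le_floor_iff)
      ultimately show ?thesis
        by (auto intro: order_trans)
    qed simp
    then have "walk N \<xi> n s \<omega> = (\<Sum>k = 1..?m. if real k / real n \<le> s then \<xi> k \<omega> * h else 0)"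
      unfolding walk_def h_def[symmetric] sum_distrib_left
      by (simp add: sum.inter_filter[symmetric] mult.commute)
    then show ?thesis
      using s by (simp add: algebra_simps sum_distrib_left sum_distrib_right if_distrib cong: if_cong sum.cong)
  qed
  ultimately have "((\<lambda>s. complex_of_real (A (t - s)) * (walk N \<xi> n s \<omega> + complex_of_real x))
      has_integral complex_of_real (drift A t) * complex_of_real x +
        (\<Sum>k = 1..?m. (\<xi> k \<omega> * h) * complex_of_real (drift A (t - real k / real n)))) {0..t}"
    by (rule has_integral_eq[OF sym, rotated])
  then show ?thesis
    unfolding h_def by (simp add: integral_unique mult.assoc)
qed

lemma scaled_roots_eq: "N > 0 \<Longrightarrow> scaled_roots N r = rotated_root N r ` {..<N}"
  unfolding scaled_roots_def rotated_root_def by (intro image_cong) auto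

lemma finite_scaled_roots: "finite (scaled_roots N r)" and scaled_roots_nonempty: "scaled_roots N r \<noteq> {}"
  by (auto simp: scaled_roots_def)

lemma inj_on_rotated_root:
  assumes "N > 0" "r \<noteq> 0"
  shows "inj_on (rotated_root N r) {..<N}"
  using assms by (auto simp: inj_on_def rotated_root_def complex_root_unity_eq cong_def)

text \<open>For \<open>r = 0\<close> the set of roots collapses to a point while the right-hand side counts this point \<open>N\<close>
  times, so the averages agree also in this case.\<close>

lemma average_over_scaled_roots:
  fixes h :: "complex \<Rightarrow> complex"
  assumes N: "N > 0"
  shows "(\<Sum>z\<in>scaled_roots N r. h z) / of_nat (card (scaled_roots N r))
    = (\<Sum>k<N. h (rotated_root N r k)) / of_nat N"
proof (cases "r = 0")
  case True
  have "scaled_roots N r = {0}"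
    using N True by (auto simp: scaled_roots_def)
  with N True show ?thesis
    by (simp add: rotated_root_def)
next
  case False
  then show ?thesis
    using N by (simp add: scaled_roots_eq sum.reindex card_image inj_on_rotated_root)
qed

lemma integral_uniform_law:
  assumes h: "continuous_on UNIV h" and N: "N > 0"
  shows "(\<integral>z. h z \<partial>uniform_law (scaled_roots N r)) = (\<Sum>k<N. h (rotated_root N r k)) / (of_nat N :: complex)"
proof -
  have "(\<integral>z. h z \<partial>uniform_law (scaled_roots N r)) = (\<integral>z. h z \<partial>measure_pmf (pmf_of_set (scaled_roots N r)))"
    unfolding uniform_law_def using borel_measurable_continuous_onI[OF h] by (subst integral_distr) auto
  also have "\<dots> = (\<Sum>z\<in>scaled_roots N r. pmf (pmf_of_set (scaled_roots N r)) z *\<^sub>R h z)"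
    using finite_scaled_roots scaled_roots_nonempty by (intro integral_measure_pmf) auto
  also have "\<dots> = (\<Sum>z\<in>scaled_roots N r. h z) / of_nat (card (scaled_roots N r))"
    using finite_scaled_roots scaled_roots_nonempty by (simp add: sum_divide_distrib scaleR_conv_of_real)
  finally show ?thesis
    by (simp only: average_over_scaled_roots[OF N])
qed

lemma AE_uniform_law: "AE z in uniform_law (scaled_roots N r). norm z \<le> norm r"
proof -
  have "norm z = norm r" if "z \<in> scaled_roots N r" for z
    using that norm_rotated_root[of N r] by (auto simp: scaled_roots_def rotated_root_def)
  then show ?thesis
    unfolding uniform_law_def using finite_scaled_roots scaled_roots_nonempty
    by (subst AE_distr_iff) (auto simp: AE_measure_pmf_iff)
qed

locale root_walk = prob_space M for M :: "'a measure" +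
  fixes N :: nat and r :: complex and \<xi> :: "nat \<Rightarrow> 'a \<Rightarrow> complex"
  assumes N: "N > 0"
    and indep: "indep_vars (\<lambda>_. borel) \<xi> {1..}"
    and law: "\<And>k. k \<ge> 1 \<Longrightarrow> distr M borel (\<xi> k) = uniform_law (scaled_roots N r)"
begin

lemma measurable_step: "k \<ge> 1 \<Longrightarrow> \<xi> k \<in> borel_measurable M"
  using indep by (simp add: indep_vars_def)

lemma AE_step_bounded: "AE \<omega> in M. \<forall>k\<ge>1. norm (\<xi> k \<omega>) \<le> norm r"
proof -
  have "AE \<omega> in M. norm (\<xi> k \<omega>) \<le> norm r" if "k \<ge> 1" for k
    using AE_uniform_law[of r N] unfolding law[OF that, symmetric]
    by (rule AE_distrD[OF measurable_step[OF that]])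
  then show ?thesis
    by (simp add: AE_all_countable)
qed

lemma expectation_exp_step:
  assumes "k \<ge> 1"
  shows "expectation (\<lambda>\<omega>. exp (\<xi> k \<omega> * z)) = step_mgf N r z"
proof -
  have "expectation (\<lambda>\<omega>. exp (\<xi> k \<omega> * z)) = (\<integral>w. exp (w * z) \<partial>distr M borel (\<xi> k))"
    using measurable_step[OF assms] by (subst integral_distr) auto
  also have "\<dots> = step_mgf N r z"
    unfolding law[OF assms] step_mgf_def using N by (intro integral_uniform_law continuous_intros)
  finally show ?thesis .
qed

lemma integrable_exp_step:
  assumes "k \<ge> 1"
  shows "integrable M (\<lambda>\<omega>. exp (\<xi> k \<omega> * z))"
proof (rule integrable_const_bound)
  show "AE \<omega> in M. norm (exp (\<xi> k \<omega> * z)) \<le> exp (norm r * norm z)"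
    using AE_step_bounded
  proof eventually_elim
    case (elim \<omega>)
    have "norm (exp (\<xi> k \<omega> * z)) \<le> exp (norm (\<xi> k \<omega> * z))"
      by (rule norm_exp)
    also have "\<dots> \<le> exp (norm r * norm z)"
      using elim assms by (simp add: norm_mult mult_right_mono)
    finally show ?case .
  qed
  show "(\<lambda>\<omega>. exp (\<xi> k \<omega> * z)) \<in> borel_measurable M"
    using measurable_step[OF assms] by measurable
qed

lemma expectation_exp_sum:
  "expectation (\<lambda>\<omega>. \<Prod>k = 1..m. exp (\<xi> k \<omega> * z k)) = (\<Prod>k = 1..m. step_mgf N r (z k))"
proof -
  have "indep_vars (\<lambda>_. borel) (\<lambda>k \<omega>. exp (\<xi> k \<omega> * z k)) {1..m}"
    by (rule indep_vars_compose2[OF indep_vars_subset[OF indep]]) auto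
  then have "expectation (\<lambda>\<omega>. \<Prod>k = 1..m. exp (\<xi> k \<omega> * z k))
      = (\<Prod>k = 1..m. expectation (\<lambda>\<omega>. exp (\<xi> k \<omega> * z k)))"
    by (rule indep_vars_lebesgue_integral[rotated]) (auto intro: integrable_exp_step)
  also have "\<dots> = (\<Prod>k = 1..m. step_mgf N r (z k))"
    by (intro prod.cong refl expectation_exp_step) auto
  finally show ?thesis .
qed

end

section \<open>The limit of the expectations\<close>

context root_walk
begin

text \<open>Multiplying \<open>f (x + W\<^sub>n(t))\<close> by the exponential of the time integral shifts every frequency \<open>iy\<close>: for the starting point \<open>x\<close> by \<open>B(t)\<close>, for the step \<open>\<xi> k\<close> by \<open>B(t - k/n)\<close>.\<close>

lemma functional_eq_superposition:
  assumes A: "continuous_on {0..} A" and t: "t \<ge> 0"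
  shows "fourier_extension \<mu> (complex_of_real x + walk N \<xi> n t \<omega>) *
      exp (integral {0..t} (\<lambda>s. complex_of_real (A (t - s)) * (walk N \<xi> n s \<omega> + complex_of_real x)))
    = complex_measure_integral \<mu> (\<lambda>y. exp (frequency A t y * complex_of_real x) *
        (\<Prod>k = 1..nat \<lfloor>real n * t\<rfloor>. exp (\<xi> k \<omega> *
          (complex_of_real (real n powr (- 1 / real N)) * frequency A (t - real k / real n) y))))"
proof -
  define h where "h = complex_of_real (real n powr (- 1 / real N))"
  define I where "I = {1..nat \<lfloor>real n * t\<rfloor>}"
  define E where "E = exp (complex_of_real (drift A t) * complex_of_real x +
      (\<Sum>k\<in>I. \<xi> k \<omega> * (h * complex_of_real (drift A (t - real k / real n)))))"
  have "exp (frequency A t y * complex_of_real x) * (\<Prod>k\<in>I. exp (\<xi> k \<omega> * (h * frequency A (t - real k / real n) y)))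
      = E * exp (\<i> * complex_of_real y * (complex_of_real x + h * (\<Sum>k\<in>I. \<xi> k \<omega>)))" for y
  proof -
    have "frequency A t y * complex_of_real x + (\<Sum>k\<in>I. \<xi> k \<omega> * (h * frequency A (t - real k / real n) y))
        = (complex_of_real (drift A t) * complex_of_real x +
            (\<Sum>k\<in>I. \<xi> k \<omega> * (h * complex_of_real (drift A (t - real k / real n))))) +
          \<i> * complex_of_real y * (complex_of_real x + h * (\<Sum>k\<in>I. \<xi> k \<omega>))"
      by (simp add: frequency_def algebra_simps sum.distrib sum_distrib_left)
    then show ?thesis
      unfolding E_def by (simp only: exp_add[symmetric] exp_sum[symmetric] I_def finite_atLeastAtMost)
  qed
  then show ?thesis
    unfolding integral_walk[OF A t] fourier_extension_def
    unfolding walk_def h_def[symmetric] I_def[symmetric] E_def[symmetric]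
    by (simp add: complex_measure_integral_mult_left mult.commute)
qed

text \<open>The steps are almost surely bounded by \<open>\<bar>r\<bar>\<close> and \<open>y\<close> ranges over a compact set, so Fubini's theorem moves the
  expectation inside the integral over \<open>y\<close>, where independence factorises it.\<close>

lemma expectation_functional:
  assumes \<mu>: "compactly_supported_complex_measure \<mu>"
    and A: "continuous_on {0..} A" and t: "t \<ge> 0"
  shows "expectation (\<lambda>\<omega>. fourier_extension \<mu> (complex_of_real x + walk N \<xi> n t \<omega>) *
      exp (integral {0..t} (\<lambda>s. complex_of_real (A (t - s)) * (walk N \<xi> n s \<omega> + complex_of_real x))))
    = complex_measure_integral \<mu> (\<lambda>y. exp (frequency A t y * complex_of_real x) *
        (\<Prod>k = 1..nat \<lfloor>real n * t\<rfloor>. step_mgf N r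
          (complex_of_real (real n powr (- 1 / real N)) * frequency A (t - real k / real n) y)))"
proof -
  interpret compactly_supported_complex_measure \<mu> by fact
  define z where "z y k = complex_of_real (real n powr (- 1 / real N)) * frequency A (t - real k / real n) y" for y k
  define m where "m = nat \<lfloor>real n * t\<rfloor>"
  define F where "F y \<omega> = exp (frequency A t y * complex_of_real x) * (\<Prod>k = 1..m. exp (\<xi> k \<omega> * z y k))" for y \<omega>
  have cont: "continuous_on S (\<lambda>y. z y k)" for k S
    unfolding z_def frequency_def by (intro continuous_intros)
  have "continuous_on UNIV (\<lambda>y. frequency A t y)"
    unfolding frequency_def by (intro continuous_intros)
  then have [measurable]: "(\<lambda>y. frequency A t y) \<in> borel_measurable borel"
    by (rule borel_measurable_continuous_onI)
  have [measurable]: "(\<lambda>y. z y k) \<in> borel_measurable borel" for k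
    using cont by (rule borel_measurable_continuous_onI)
  have step [measurable]: "(\<lambda>p. \<xi> k (snd p)) \<in> borel_measurable (borel \<Otimes>\<^sub>M M)" if "k \<in> {1..m}" for k
    using measurable_step[of k] that by (intro measurable_compose[OF measurable_snd]) auto
  have F: "(\<lambda>(y, \<omega>). F y \<omega>) \<in> borel_measurable (borel \<Otimes>\<^sub>M M)"
    unfolding F_def case_prod_beta
    by (intro borel_measurable_times borel_measurable_prod borel_measurable_exp step) measurable
  have "bounded ((\<lambda>y. exp (frequency A t y * complex_of_real x)) ` measure_support \<mu>)"
    unfolding frequency_def
    by (intro compact_imp_bounded compact_continuous_image continuous_intros compact_support)
  then obtain C where C: "\<And>y. y \<in> measure_support \<mu> \<Longrightarrow> norm (exp (frequency A t y * complex_of_real x)) \<le> C"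
    unfolding bounded_iff by blast
  have "\<exists>Z. \<forall>y\<in>measure_support \<mu>. norm (z y k) \<le> Z" for k
    using compact_imp_bounded[OF compact_continuous_image[OF cont compact_support, of k]]
    unfolding bounded_iff by blast
  then obtain Z where Z: "\<And>k y. y \<in> measure_support \<mu> \<Longrightarrow> norm (z y k) \<le> Z k"
    by metis
  have "AE \<omega> in M. \<forall>y\<in>measure_support \<mu>. norm (F y \<omega>) \<le> C * (\<Prod>k = 1..m. exp (norm r * Z k))"
    using AE_step_bounded
  proof eventually_elim
    case (elim \<omega>)
    show ?case
    proof
      fix y assume y: "y \<in> measure_support \<mu>"
      have "norm (\<Prod>k = 1..m. exp (\<xi> k \<omega> * z y k)) = (\<Prod>k = 1..m. norm (exp (\<xi> k \<omega> * z y k)))"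
        by (rule prod_norm[symmetric])
      also have "\<dots> \<le> (\<Prod>k = 1..m. exp (norm r * Z k))"
      proof (rule prod_mono, safe)
        fix k assume k: "k \<in> {1..m}"
        have "norm (exp (\<xi> k \<omega> * z y k)) \<le> exp (norm (\<xi> k \<omega> * z y k))"
          by (rule norm_exp)
        also have "\<dots> \<le> exp (norm r * Z k)"
          using elim k Z[OF y, of k] by (auto simp: norm_mult intro!: mult_mono)
        finally show "norm (exp (\<xi> k \<omega> * z y k)) \<le> exp (norm r * Z k)" .
      qed simp
      finally show "norm (F y \<omega>) \<le> C * (\<Prod>k = 1..m. exp (norm r * Z k))"
        unfolding F_def norm_mult using C[OF y] order_trans[OF norm_ge_zero C[OF y]]
        by (intro mult_mono) auto
    qed
  qed
  then have "expectation (\<lambda>\<omega>. complex_measure_integral \<mu> (\<lambda>y. F y \<omega>))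
      = complex_measure_integral \<mu> (\<lambda>y. expectation (F y))"
    by (rule Fubini_bounded[OF prob_space_axioms F])
  also have "\<dots> = complex_measure_integral \<mu> (\<lambda>y. exp (frequency A t y * complex_of_real x) *
      (\<Prod>k = 1..m. step_mgf N r (z y k)))"
    unfolding F_def[abs_def] by (simp only: integral_mult_right_zero expectation_exp_sum)
  finally show ?thesis
    unfolding functional_eq_superposition[OF A t] F_def z_def m_def .
qed

text \<open>The products converge for each \<open>y\<close> and are bounded uniformly on the support, because \<open>L\<close> bounds all
  frequencies that occur; bounded convergence carries the limit through the integral over \<open>y\<close>.\<close>

lemma expectation_functional_tendsto:
  assumes \<mu>: "compactly_supported_complex_measure \<mu>"
    and A: "continuous_on {0..} A" and t: "t \<ge> 0"
  shows "(\<lambda>n. expectation (\<lambda>\<omega>. fourier_extension \<mu> (complex_of_real x + walk N \<xi> n t \<omega>) *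
      exp (integral {0..t} (\<lambda>s. complex_of_real (A (t - s)) * (walk N \<xi> n s \<omega> + complex_of_real x)))))
    \<longlonglongrightarrow> complex_measure_integral \<mu> (\<lambda>y. mode N (r ^ N) A t x y)"
proof -
  interpret compactly_supported_complex_measure \<mu> by fact
  have cont: "continuous_on {0..t} (\<lambda>s. frequency A (t - s) y)" for y
    by (rule continuous_on_compose2[OF continuous_on_frequency[OF A]]) (auto intro!: continuous_intros)
  obtain R where R: "\<And>y. y \<in> measure_support \<mu> \<Longrightarrow> \<bar>y\<bar> \<le> R"
    using compact_imp_bounded[OF compact_support] unfolding bounded_iff by auto
  have "bounded (drift A ` {0..t})"
    using continuous_on_subset[OF continuous_on_drift[OF A], of "{0..t}"]
    by (intro compact_imp_bounded compact_continuous_image) auto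
  then obtain b where b: "\<bar>drift A s\<bar> \<le> b" if "s \<in> {0..t}" for s
    unfolding bounded_iff real_norm_def by blast
  define L where "L = \<bar>R\<bar> + b"
  have "b \<ge> 0"
    using b[of 0] t by auto
  then have "L \<ge> 0"
    by (simp add: L_def)
  have frequency_le: "norm (frequency A (t - s) y) \<le> L" if "y \<in> measure_support \<mu>" "s \<in> {0..t}" for y s
  proof -
    have "norm (frequency A (t - s) y) \<le> \<bar>y\<bar> + \<bar>drift A (t - s)\<bar>"
      unfolding frequency_def by (rule order_trans[OF norm_triangle_ineq]) (simp add: norm_mult)
    also have "\<dots> \<le> L"
      using R[OF that(1)] b[of "t - s"] that(2) by (auto simp: L_def)
    finally show ?thesis .
  qed
  interpret germ: order_N_germ "step_mgf N r" N "r ^ N / fact N" L "exp (norm r * L) * norm r ^ Suc N / fact N"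
    using N \<open>L \<ge> 0\<close> by (rule step_mgf_germ)
  show ?thesis
    unfolding expectation_functional[OF assms]
  proof (rule bounded_convergence[where C = "exp (drift A t * x) * exp (germ.growth * t)"])
    show "continuous_on UNIV (\<lambda>y. exp (frequency A t y * complex_of_real x) *
        (\<Prod>k = 1..nat \<lfloor>real n * t\<rfloor>. step_mgf N r
          (complex_of_real (real n powr (- 1 / real N)) * frequency A (t - real k / real n) y)))" for n
      unfolding frequency_def step_mgf_def using N by (intro continuous_intros) auto
    show "continuous_on UNIV (\<lambda>y. mode N (r ^ N) A t x y)"
      using continuous_on_mode_section[OF A t, of 0] by simp
  next
    fix y assume y: "y \<in> measure_support \<mu>"
    have "(\<lambda>n. \<Prod>k = 1..nat \<lfloor>real n * t\<rfloor>. step_mgf N r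
          (complex_of_real (real n powr (- 1 / real N)) * frequency A (t - real k / real n) y))
        \<longlonglongrightarrow> exp (r ^ N / fact N * integral {0..t} (\<lambda>s. frequency A (t - s) y ^ N))"
      using t cont frequency_le[OF y] by (rule germ.prod_scaled_tendsto)
    moreover have "integral {0..t} (\<lambda>s. frequency A (t - s) y ^ N) = phase N A t y"
      using has_integral_time_reversed[of "\<lambda>s. frequency A s y ^ N" 0 t] continuous_on_frequency[OF A] t
      by (simp add: phase_def integral_unique continuous_on_power)
    ultimately show "(\<lambda>n. exp (frequency A t y * complex_of_real x) *
        (\<Prod>k = 1..nat \<lfloor>real n * t\<rfloor>. step_mgf N r
          (complex_of_real (real n powr (- 1 / real N)) * frequency A (t - real k / real n) y)))
        \<longlonglongrightarrow> mode N (r ^ N) A t x y"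
      unfolding mode_def exp_add by (auto intro: tendsto_mult_left)
    fix n
    have "norm (exp (frequency A t y * complex_of_real x)) = exp (drift A t * x)"
      by (simp add: frequency_def)
    moreover have "norm (\<Prod>k = 1..nat \<lfloor>real n * t\<rfloor>. step_mgf N r
          (complex_of_real (real n powr (- 1 / real N)) * frequency A (t - real k / real n) y)) \<le> exp (germ.growth * t)"
      using t frequency_le[OF y] by (rule germ.norm_prod_scaled_le)
    ultimately show "norm (exp (frequency A t y * complex_of_real x) *
        (\<Prod>k = 1..nat \<lfloor>real n * t\<rfloor>. step_mgf N r
          (complex_of_real (real n powr (- 1 / real N)) * frequency A (t - real k / real n) y)))
        \<le> exp (drift A t * x) * exp (germ.growth * t)"
      unfolding norm_mult by (simp only: mult_left_mono exp_ge_zero)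
  qed
qed

end

theorem theorem21:
  fixes N :: nat and \<alpha> r :: complex
    and M :: "'a measure" and \<xi> :: "nat \<Rightarrow> 'a \<Rightarrow> complex"
    and A :: "real \<Rightarrow> real" and \<mu> :: "real set \<Rightarrow> complex" and f :: "real \<Rightarrow> complex"
  assumes "N > 2"
    and "r ^ N = \<alpha>"
    and "prob_space M"
    and "prob_space.indep_vars M (\<lambda>_. borel) \<xi> {1..}"
    and "\<And>k. k \<ge> 1 \<Longrightarrow> distr M borel (\<xi> k) = uniform_law (scaled_roots N r)"
    and "continuous_on {0..} A"
    and "complex_borel_measure \<mu>"
    and "compact (measure_support \<mu>)"
    and "\<And>x. f x = fourier_extension \<mu> (complex_of_real x)"
  shows "\<exists>u. classical_solution N \<alpha> A f u \<and>
    (\<forall>t\<ge>0. \<forall>x. (\<lambda>n. prob_space.expectation M (\<lambda>\<omega>.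
        fourier_extension \<mu> (complex_of_real x + walk N \<xi> n t \<omega>) *
        exp (integral {0..t} (\<lambda>s. complex_of_real (A (t - s)) *
                                  (walk N \<xi> n s \<omega> + complex_of_real x)))))
      \<longlonglongrightarrow> u t x)"
proof -
  interpret \<mu>: compactly_supported_complex_measure \<mu>
    by unfold_locales (fact assms)+
  have walk: "root_walk M N r \<xi>"
    unfolding root_walk_def root_walk_axioms_def using assms(1,3-5) by auto
  have "classical_solution N \<alpha> A f (\<lambda>t x. complex_measure_integral \<mu> (\<lambda>y. mode N \<alpha> A t x y))"
    using assms(6,9) by (rule \<mu>.classical_solution_superposition)
  moreover note root_walk.expectation_functional_tendsto[OF walk \<mu>.compactly_supported_complex_measure_axioms assms(6)]
  ultimately show ?thesis
    unfolding assms(2) by blast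
qed

end
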